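(* Consider $n$ jobs on a single machine with weights $w_j\ge0$, release dates $r_j\ge0$, independent non-negative random processing times $\bm p_j$ with $\bar p_j=\mathrm E[\bm p_j]>0$, indexed so that $w_1/\bar p_1\ge\cdots\ge w_n/\bar p_n$, and assume all processing times are $\delta$-NBUE for some $\delta\ge1$. Let $f$ be a probability density function on $(0,1]$ and $c\in\mathbb R$ such that for every $x\in(0,1]$: (1) $\int_0^x\frac{\delta}{\delta+x-\alpha}f(\alpha)\,\mathrm d\alpha\le(c-1)x$; (2) $\bigl(1+\int_0^1\frac{\delta}{\delta+1-\alpha}f(\alpha)\,\mathrm d\alpha\bigr)\int_{1-x}^1f(\alpha)\,\mathrm d\alpha\le cx$. Then \[\mathrm E\Bigl[\sum_{j=1}^nw_j\bm C_j^{\mathrm{RSOS}(f)}\Bigr]\le c\sum_{j=1}^nw_j\Bigl(M_j^{\mathrm{S^p}}+\frac{\bar p_j}2\Bigr)\le c\,\mathrm E\Bigl[\sum_{j=1}^nw_j\bm C_j^{\mathrm{OPT}}\Bigr],\] where $\mathrm{OPT}$ is an optimal (non-preemptive, non-anticipative) scheduling policy.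
   Context: A non-negative random variable $\bm X$ is $\delta$-NBUE if $\mathrm E[\bm X-t\mid\bm X>t]\le\delta\,\mathrm E[\bm X]$ for all $t\ge0$. Scheduling policies are non-preemptive, never start $j$ before $r_j$, and are non-anticipative. $\mathrm{S^p}$ is the preemptive WSPT schedule of the deterministic counterparts (processing times $\bar p_j$): at each time the released unfinished job of smallest index is processed; $I_j^{\mathrm{S^p}}(t)\in\{0,1\}$ indicates processing of $j$ at $t$; $M_j^{\mathrm{S^p}}:=\frac1{\bar p_j}\int_0^\infty I_j^{\mathrm{S^p}}(t)t\,\mathrm dt$; the $\alpha$-point is $C_j(\alpha):=\min\{t\ge0:\int_0^tI_j^{\mathrm{S^p}}(s)\mathrm ds\ge\alpha\bar p_j\}$. The $\mathrm{RSOS}(f)$ policy: at release of $j$ draw $\bm\alpha_j\in(0,1]$ with density $f$, independently of everything else; construct $\mathrm{S^p}$ virtually over time; append $j$ to a FIFO queue at time $C_j(\bm\alpha_j)$; the machine processes the queue in FIFO order without idling while the queue is nonempty. *)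

theory Defs
  imports "HOL-Probability.Probability"
begin

definition delta_NBUE :: "'a measure \<Rightarrow> real \<Rightarrow> ('a \<Rightarrow> real) \<Rightarrow> bool" where
  "delta_NBUE M \<delta> X \<longleftrightarrow>
     (\<forall>t\<ge>0. measure M {\<omega> \<in> space M. X \<omega> > t} > 0 \<longrightarrow>
        (LINT \<omega>:{\<omega> \<in> space M. X \<omega> > t}|M. X \<omega> - t) / measure M {\<omega> \<in> space M. X \<omega> > t}
          \<le> \<delta> * (LINT \<omega>|M. X \<omega>))"

definition pdf_on_unit :: "(real \<Rightarrow> real) \<Rightarrow> bool" where
  "pdf_on_unit f \<longleftrightarrow> set_integrable lborel {0<..1} f \<and> (\<forall>x\<in>{0<..1}. 0 \<le> f x)
     \<and> (LBINT x:{0<..1}. f x) = 1"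


subsection \<open>The virtual preemptive WSPT schedule\<close>

text \<open>
  \<open>sp_pending r q j t\<close> says that job \<open>j\<close> is released and unfinished at time \<open>t\<close> in the preemptive
  schedule with release dates \<open>r\<close> and processing times \<open>q\<close> in which smaller indices have priority.
  To obtain a recursion on the index, the work done on \<open>j\<close> until \<open>t\<close> is expressed by the amount
  of time in \<open>[r j, t]\<close> during which no job of smaller index is pending (this is the work done on
  \<open>j\<close>, up to truncation at \<open>q j\<close>). Lemmas \<open>sp_pending_iff\<close> and \<open>sp_ind_iff_Min\<close> below recover the
  usual description: at each time the released unfinished job of smallest index is processed.
\<close>

fun sp_pending :: "(nat \<Rightarrow> real) \<Rightarrow> (nat \<Rightarrow> real) \<Rightarrow> nat \<Rightarrow> real \<Rightarrow> bool" where
  "sp_pending r q j t \<longleftrightarrow> r j \<le> t \<and>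
     measure lborel {s \<in> {r j..t}. \<forall>k\<in>{1..<j}. \<not> sp_pending r q k s} < q j"

declare sp_pending.simps [simp del]

definition sp_ind :: "(nat \<Rightarrow> real) \<Rightarrow> (nat \<Rightarrow> real) \<Rightarrow> nat \<Rightarrow> real \<Rightarrow> real" where
  "sp_ind r q j t = of_bool (sp_pending r q j t \<and> (\<forall>k\<in>{1..<j}. \<not> sp_pending r q k t))"

definition sp_mean_busy_time :: "(nat \<Rightarrow> real) \<Rightarrow> (nat \<Rightarrow> real) \<Rightarrow> nat \<Rightarrow> real" where
  "sp_mean_busy_time r q j = 1 / q j * (LBINT t:{0..}. sp_ind r q j t * t)"

definition alpha_point :: "(nat \<Rightarrow> real) \<Rightarrow> (nat \<Rightarrow> real) \<Rightarrow> nat \<Rightarrow> real \<Rightarrow> real" where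
  "alpha_point r q j \<alpha> = (LEAST t. 0 \<le> t \<and> (LBINT s:{0..t}. sp_ind r q j s) \<ge> \<alpha> * q j)"

lemma sets_sp_pending: "{s. sp_pending r q j s} \<in> sets lborel"
proof (induction j rule: less_induct)
  case (less j)
  define F where "F = {s. \<forall>k\<in>{1..<j}. \<not> sp_pending r q k s}"
  have F: "F \<in> sets lborel"
  proof -
    have "F = space lborel - (\<Union>k\<in>{1..<j}. {s. sp_pending r q k s})" by (auto simp: F_def)
    then show ?thesis using less by (auto intro!: sets.Diff sets.finite_UN)
  qed
  have eq: "{s \<in> {r j..t}. \<forall>k\<in>{1..<j}. \<not> sp_pending r q k s} = {r j..t} \<inter> F" for t
    by (auto simp: F_def)
  have "mono (\<lambda>t. measure lborel ({r j..t} \<inter> F))"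
  proof (rule monoI)
    fix s t :: real assume "s \<le> t"
    have "emeasure lborel ({r j..t} \<inter> F) \<le> emeasure lborel {r j..t}"
      using F by (intro emeasure_mono) auto
    also have "\<dots> < \<infinity>" by (simp add: emeasure_lborel_Icc_eq)
    finally have "{r j..t} \<inter> F \<in> fmeasurable lborel" using F by (intro fmeasurableI) auto
    then show "measure lborel ({r j..s} \<inter> F) \<le> measure lborel ({r j..t} \<inter> F)"
      using F \<open>s \<le> t\<close> by (intro measure_mono_fmeasurable) auto
  qed
  then have [measurable]: "(\<lambda>t. measure lborel ({r j..t} \<inter> F)) \<in> borel_measurable borel"
    by (rule borel_measurable_mono)
  show ?case
    by (subst sp_pending.simps, unfold eq) measurable
qed

lemma sp_pending_iff:
  assumes "0 \<le> r j" and "0 < q j"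
  shows "sp_pending r q j t \<longleftrightarrow> r j \<le> t \<and> (LBINT s:{0..t}. sp_ind r q j s) < q j"
proof (cases "r j \<le> t")
  case False
  then show ?thesis by (subst sp_pending.simps) simp
next
  case True
  define F where "F = {s. \<forall>k\<in>{1..<j}. \<not> sp_pending r q k s}"
  define W where "W = (\<lambda>t. measure lborel ({r j..t} \<inter> F))"
  have F [measurable]: "F \<in> sets lborel"
  proof -
    have "F = space lborel - (\<Union>k\<in>{1..<j}. {s. sp_pending r q k s})" by (auto simp: F_def)
    then show ?thesis using sets_sp_pending by (auto intro!: sets.Diff sets.finite_UN)
  qed
  have eq: "{s \<in> {r j..t}. \<forall>k\<in>{1..<j}. \<not> sp_pending r q k s} = {r j..t} \<inter> F" for t
    by (auto simp: F_def)
  have pend: "sp_pending r q j s \<longleftrightarrow> r j \<le> s \<and> W s < q j" for s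
    by (subst sp_pending.simps, unfold eq W_def) simp
  have fm: "A \<inter> F \<in> fmeasurable lborel" if "A \<subseteq> {a..b}" "A \<in> sets lborel" for A and a b :: real
  proof (rule fmeasurableI)
    show "A \<inter> F \<in> sets lborel" using that(2) F by (rule sets.Int)
    have "emeasure lborel (A \<inter> F) \<le> emeasure lborel {a..b}"
      using that F by (intro emeasure_mono) auto
    also have "\<dots> < \<infinity>" by (simp add: emeasure_lborel_Icc_eq)
    finally show "emeasure lborel (A \<inter> F) < \<infinity>" .
  qed
  have diff: "W b = W a + measure lborel ({a<..b} \<inter> F)" if "r j \<le> a" "a \<le> b" for a b
  proof -
    have "{r j..b} \<inter> F = ({r j..a} \<inter> F) \<union> ({a<..b} \<inter> F)" using that by auto
    moreover have "measure lborel (({r j..a} \<inter> F) \<union> ({a<..b} \<inter> F)) =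
        measure lborel ({r j..a} \<inter> F) + measure lborel ({a<..b} \<inter> F)"
      using that by (intro measure_Un_AE fm[of _ "r j" b]) auto
    ultimately show ?thesis by (simp add: W_def)
  qed
  have lip: "W a \<le> W b \<and> W b \<le> W a + (b - a)" if "r j \<le> a" "a \<le> b" for a b
  proof -
    have "measure lborel ({a<..b} \<inter> F) \<le> measure lborel {a..b}"
      using F by (intro measure_mono_fmeasurable) (auto intro!: fmeasurableI simp: emeasure_lborel_Icc_eq)
    then show ?thesis using diff[OF that] that by simp
  qed
  have W0: "W (r j) = 0"
  proof -
    have "measure lborel ({r j..r j} \<inter> F) \<le> measure lborel {r j..r j}"
      using F by (intro measure_mono_fmeasurable) (auto intro!: fmeasurableI simp: emeasure_lborel_Icc_eq)
    then show ?thesis by (simp add: W_def measure_le_0_iff)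
  qed
  have cont: "continuous_on {r j..t} W"
  proof (rule lipschitz_on_continuous_on[where L=1], rule lipschitz_onI)
    fix a b assume "a \<in> {r j..t}" "b \<in> {r j..t}"
    then show "dist (W a) (W b) \<le> 1 * dist a b"
      using lip[of a b] lip[of b a] by (cases "a \<le> b") (auto simp: dist_real_def abs_real_def)
  qed simp
  have "(LBINT s:{0..t}. sp_ind r q j s) = (LBINT s. indicator ({s\<in>{r j..t}. W s < q j} \<inter> F) s)"
    unfolding set_lebesgue_integral_def
    by (intro Bochner_Integration.integral_cong refl)
       (use assms(1) in \<open>auto simp: sp_ind_def pend F_def indicator_def\<close>)
  also have "\<dots> = measure lborel ({s\<in>{r j..t}. W s < q j} \<inter> F)" by simp
  finally have int: "(LBINT s:{0..t}. sp_ind r q j s) = measure lborel ({s\<in>{r j..t}. W s < q j} \<inter> F)" .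
  show ?thesis
  proof (cases "W t < q j")
    case lt: True
    have "{s\<in>{r j..t}. W s < q j} = {r j..t}" using lip lt True by fastforce
    then show ?thesis using int lt True pend by (simp add: W_def)
  next
    case ge: False
    obtain T where T: "r j \<le> T" "T \<le> t" "W T = q j"
      using IVT'[of W "r j" "q j" t] W0 assms ge True cont by auto
    define B where "B = {s\<in>{r j..t}. W s < q j}"
    have Bm: "B \<in> sets lborel"
    proof -
      have "B = {r j..t} \<inter> {s. sp_pending r q j s}" by (auto simp: B_def pend)
      then show ?thesis using sets_sp_pending[of r q j] by auto
    qed
    define T0 where "T0 = Sup B"
    have Bne: "r j \<in> B" using True W0 assms by (auto simp: B_def)
    have Bup: "s < T" if "s \<in> B" for s using that lip[of T s] T by (force simp: B_def)
    have Bbd: "bdd_above B" using Bup by (intro bdd_aboveI[of _ T]) (auto intro: less_imp_le)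
    have T0: "r j \<le> T0" "T0 \<le> T"
      unfolding T0_def using Bne Bup Bbd cSup_upper[of "r j" B] cSup_least[of B T]
      by (auto intro: less_imp_le)
    have sub: "{r j..<T0} \<subseteq> B"
    proof
      fix s assume s: "s \<in> {r j..<T0}"
      then obtain b where "b \<in> B" "s < b" using Bne less_cSupE[of s B] unfolding T0_def by auto
      then show "s \<in> B" using lip[of s b] s by (auto simp: B_def)
    qed
    have "W T0 \<ge> q j"
    proof (rule ccontr)
      assume nle: "\<not> q j \<le> W T0"
      define e where "e = min ((q j - W T0) / 2) (T - T0)"
      have "e \<le> T - T0" by (simp add: e_def)
      have "T0 \<noteq> T" using T nle by auto
      then have "e > 0" using T0 nle by (auto simp: e_def)
      have "W (T0 + e) \<le> W T0 + e" using lip[of T0 "T0 + e"] T0 \<open>e > 0\<close> by auto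
      also have "\<dots> < q j" using nle by (auto simp: e_def min_def field_simps split: if_splits)
      finally have "T0 + e \<in> B" using T0 T \<open>e > 0\<close> \<open>e \<le> T - T0\<close> by (auto simp: B_def)
      then have "T0 + e \<le> T0" unfolding T0_def
        using Bbd by (rule cSup_upper)
      then show False using \<open>e > 0\<close> by simp
    qed
    also have "W T0 \<le> measure lborel ((B \<inter> F) \<union> {T0})"
      unfolding W_def
    proof (rule measure_mono_fmeasurable)
      show "{r j..T0} \<inter> F \<subseteq> B \<inter> F \<union> {T0}" using sub by force
      show "{r j..T0} \<inter> F \<in> sets lborel" using F by auto
      have "B \<inter> F \<in> fmeasurable lborel" using Bm by (intro fm[of B "r j" t]) (auto simp: B_def)
      then show "B \<inter> F \<union> {T0} \<in> fmeasurable lborel"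
        by (rule fmeasurable.Un) (auto intro!: fmeasurableI)
    qed
    also have "\<dots> \<le> measure lborel (B \<inter> F) + measure lborel {T0}"
      by (rule measure_Un_le) (use Bm F in auto)
    finally have "q j \<le> measure lborel (B \<inter> F)" by simp
    then show ?thesis using int ge pend by (simp add: B_def)
  qed
qed

lemma sp_ind_iff_Min:
  assumes "\<And>j. j \<in> {1..n} \<Longrightarrow> 0 \<le> r j" and "\<And>j. j \<in> {1..n} \<Longrightarrow> 0 < q j" and "j \<in> {1..n}"
  defines "U \<equiv> \<lambda>t. {k \<in> {1..n}. r k \<le> t \<and> (LBINT s:{0..t}. sp_ind r q k s) < q k}"
  shows "sp_ind r q j t = (if U t \<noteq> {} \<and> j = Min (U t) then 1 else 0)"
proof -
  have U: "U t = {k \<in> {1..n}. sp_pending r q k t}"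
    using assms(1,2) by (auto simp: U_def sp_pending_iff)
  have fin: "finite (U t)" by (simp add: U)
  have "U t \<noteq> {} \<and> j = Min (U t) \<longleftrightarrow> j \<in> U t \<and> (\<forall>k\<in>U t. j \<le> k)"
    using fin by (metis Min_eqI Min_in Min_le empty_iff)
  also have "\<dots> \<longleftrightarrow> sp_pending r q j t \<and> (\<forall>k\<in>{1..<j}. \<not> sp_pending r q k t)"
    using assms(3) by (auto simp: U not_less[symmetric])
  finally show ?thesis by (simp add: sp_ind_def)
qed


subsection \<open>The RSOS policy\<close>

text \<open>
  \<open>fifo_completion a x t js\<close>: the machine is free from time \<open>t\<close> on, the jobs \<open>js\<close> (listed in the order
  of their queue entry times \<open>a\<close>) are still to be processed, and \<open>x\<close> are the processing times.
\<close>

fun fifo_completion :: "(nat \<Rightarrow> real) \<Rightarrow> (nat \<Rightarrow> real) \<Rightarrow> real \<Rightarrow> nat list \<Rightarrow> nat \<Rightarrow> real" where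
  "fifo_completion a x t [] = (\<lambda>_. 0)"
| "fifo_completion a x t (j # js) =
     (let C = max t (a j) + x j in (fifo_completion a x C js)(j := C))"

text \<open>
  Distinct jobs never enter the queue simultaneously for \<open>\<alpha> j \<in> (0,1]\<close>, so the order in which
  \<^const>\<open>sort_key\<close> puts equal keys is immaterial.
\<close>

definition rsos_completion ::
  "nat \<Rightarrow> (nat \<Rightarrow> real) \<Rightarrow> (nat \<Rightarrow> real) \<Rightarrow> (nat \<Rightarrow> real) \<Rightarrow> (nat \<Rightarrow> real) \<Rightarrow> nat \<Rightarrow> real" where
  "rsos_completion n r q \<alpha> x =
     (let a = (\<lambda>j. alpha_point r q j (\<alpha> j))
      in fifo_completion a x 0 (sort_key a [1..<Suc n]))"

definition rsos_cost ::
  "nat \<Rightarrow> (nat \<Rightarrow> real) \<Rightarrow> (nat \<Rightarrow> real) \<Rightarrow> 'a measure \<Rightarrow> (nat \<Rightarrow> 'a \<Rightarrow> real) \<Rightarrow> (real \<Rightarrow> real) \<Rightarrow> ennreal" where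
  "rsos_cost n w r M p f =
     (\<integral>\<^sup>+ (\<omega>, \<alpha>). ennreal (\<Sum>j=1..n. w j *
          rsos_completion n r (\<lambda>k. LINT \<omega>'|M. p k \<omega>') \<alpha> (\<lambda>k. p k \<omega>) j)
      \<partial>(M \<Otimes>\<^sub>M PiM {1..n} (\<lambda>_. density lborel (\<lambda>y. ennreal (indicator {0<..1} y * f y)))))"


subsection \<open>Scheduling policies\<close>

text \<open>
  On a single machine without preemption no job can be started while another one is running, and
  no information is revealed while the machine is idle (release dates are fixed). A non-anticipative
  policy therefore decides, initially and after each completion, which job to start next and at
  which time, on the basis of the jobs completed so far with their start times and observed
  processing times (listed in chronological order). Policies may be randomized: the first argument
  is a random seed, drawn uniformly from \<open>[0,1]\<close> independently of the processing times.
  Measurability is only required of the resulting completion times.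
\<close>

type_synonym history = "(nat \<times> real \<times> real) list"
type_synonym policy = "real \<Rightarrow> history \<Rightarrow> nat \<times> real"

primrec run :: "policy \<Rightarrow> real \<Rightarrow> (nat \<Rightarrow> real) \<Rightarrow> nat \<Rightarrow> history" where
  "run \<pi> u x 0 = []"
| "run \<pi> u x (Suc m) =
     (let h = run \<pi> u x m; (j, s) = \<pi> u h in h @ [(j, s, x j)])"

definition completion :: "policy \<Rightarrow> real \<Rightarrow> (nat \<Rightarrow> real) \<Rightarrow> nat \<Rightarrow> nat \<Rightarrow> real" where
  "completion \<pi> u x n j = (let (s, y) = the (map_of (run \<pi> u x n) j) in s + y)"

definition scheduling_policy :: "nat \<Rightarrow> (nat \<Rightarrow> real) \<Rightarrow> policy \<Rightarrow> bool" where
  "scheduling_policy n r \<pi> \<longleftrightarrow>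
     (\<forall>u\<in>{0..1}. \<forall>x. (\<forall>j\<in>{1..n}. 0 \<le> x j) \<longrightarrow>
        (let h = run \<pi> u x n in
           distinct (map fst h) \<and> set (map fst h) = {1..n} \<and>
           (\<forall>(j, s, y)\<in>set h. r j \<le> s) \<and>
           sorted_wrt (\<lambda>(i, s, y) (j, s', y'). s + y \<le> s') h)) \<and>
     (\<forall>j\<in>{1..n}. (\<lambda>(u, x). completion \<pi> u x n j)
        \<in> borel_measurable (borel \<Otimes>\<^sub>M PiM {1..n} (\<lambda>_. borel)))"

text \<open>Policies exist: the jobs can be processed in the order of their indices.\<close>

lemma scheduling_policy_exists: "\<exists>\<pi>. scheduling_policy n r \<pi>"
proof -
  define \<pi> :: policy where "\<pi> = (\<lambda>u h. (Suc (length h),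
     max (if h = [] then 0 else case last h of (j, s, y) \<Rightarrow> s + y) (r (Suc (length h)))))"
  define c :: "(nat \<Rightarrow> real) \<Rightarrow> nat \<Rightarrow> real"
    where "c = (\<lambda>x. rec_nat 0 (\<lambda>m C. max C (r (Suc m)) + x (Suc m)))"
  have c0: "c x 0 = 0" and cS: "c x (Suc m) = max (c x m) (r (Suc m)) + x (Suc m)" for x m
    by (simp_all add: c_def)
  define g where "g = (\<lambda>x i. (Suc i, max (c x i) (r (Suc i)), x (Suc i)))"
  have run: "run \<pi> u x m = map (g x) [0..<m]" for u x m
  proof (induction m)
    case (Suc m)
    then show ?case by (cases m) (auto simp: \<pi>_def g_def c0 cS Let_def)
  qed simp
  have mono: "c x i \<le> c x k" if "\<forall>j\<in>{1..n}. 0 \<le> x j" "i \<le> k" "k \<le> n" for x i k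
    using that(2,3)
  proof (induction k rule: dec_induct)
    case (step k)
    then show ?case using that(1)[rule_format, of "Suc k"] by (simp add: cS)
  qed simp
  have fst: "map fst (run \<pi> u x n) = [1..<Suc n]" for u x
    by (simp add: run g_def comp_def map_Suc_upt[symmetric] del: upt_Suc)
  have comp: "completion \<pi> u x n j = c x j" if "j \<in> {1..n}" for u x j
  proof -
    have "g x (j - 1) \<in> set (run \<pi> u x n)" using that by (auto simp: run)
    moreover have "distinct (map fst (run \<pi> u x n))" by (simp only: fst distinct_upt)
    ultimately have "map_of (run \<pi> u x n) j = Some (snd (g x (j - 1)))"
      using that by (intro map_of_is_SomeI) (auto simp: g_def)
    then show ?thesis using that by (cases j) (auto simp: completion_def g_def cS)
  qed
  have cm: "j \<le> n \<Longrightarrow> (\<lambda>(u::real, x). c x j) \<in> borel_measurable (borel \<Otimes>\<^sub>M PiM {1..n} (\<lambda>_. borel))"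
    for j
  proof (induction j)
    case (Suc j)
    have [measurable]: "(\<lambda>z::real \<times> _. c (snd z) j) \<in> borel_measurable (borel \<Otimes>\<^sub>M PiM {1..n} (\<lambda>_. borel))"
      using Suc by (simp add: case_prod_beta')
    have [measurable]: "Suc j \<in> {1..n}" using Suc by simp
    show ?case unfolding case_prod_beta' cS by measurable
  qed (simp add: c0)
  have "scheduling_policy n r \<pi>"
    unfolding scheduling_policy_def Let_def
  proof (intro conjI ballI allI impI)
    fix u :: real and x :: "nat \<Rightarrow> real" assume x: "\<forall>j\<in>{1..n}. 0 \<le> x j"
    show "distinct (map fst (run \<pi> u x n))" "set (map fst (run \<pi> u x n)) = {1..n}"
      by (simp_all only: fst distinct_upt set_upt atLeastLessThanSuc_atLeastAtMost)
    show "case z of (j, s, y) \<Rightarrow> r j \<le> s" if "z \<in> set (run \<pi> u x n)" for z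
      using that by (auto simp: run g_def)
    show "sorted_wrt (\<lambda>(i, s, y) (j, s', y'). s + y \<le> s') (run \<pi> u x n)"
      unfolding run sorted_wrt_map
    proof (rule sorted_wrt_mono_rel[OF _ sorted_wrt_upt])
      fix i k assume "i \<in> set [0..<n]" "k \<in> set [0..<n]" "i < k"
      then show "(case g x i of (i, s, y) \<Rightarrow> \<lambda>(j, s', y'). s + y \<le> s') (g x k)"
        using mono[OF x, of "Suc i" k] by (simp add: g_def cS)
    qed
  next
    fix j assume j: "j \<in> {1..n}"
    then show "(\<lambda>(u, x). completion \<pi> u x n j)
        \<in> borel_measurable (borel \<Otimes>\<^sub>M PiM {1..n} (\<lambda>_. borel))"
      using cm[of j] by (simp add: comp)
  qed
  then show ?thesis by blast
qed

definition policy_cost ::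
  "nat \<Rightarrow> (nat \<Rightarrow> real) \<Rightarrow> 'a measure \<Rightarrow> (nat \<Rightarrow> 'a \<Rightarrow> real) \<Rightarrow> policy \<Rightarrow> ennreal" where
  "policy_cost n w M p \<pi> =
     (\<integral>\<^sup>+ (u, \<omega>). ennreal (\<Sum>j=1..n. w j * completion \<pi> u (\<lambda>k\<in>{1..n}. p k \<omega>) n j)
      \<partial>(uniform_measure lborel {0..1} \<Otimes>\<^sub>M M))"

definition optimal_policy ::
  "nat \<Rightarrow> (nat \<Rightarrow> real) \<Rightarrow> (nat \<Rightarrow> real) \<Rightarrow> 'a measure \<Rightarrow> (nat \<Rightarrow> 'a \<Rightarrow> real) \<Rightarrow> policy \<Rightarrow> bool" where
  "optimal_policy n w r M p \<pi> \<longleftrightarrow> scheduling_policy n r \<pi> \<and>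
     (\<forall>\<sigma>. scheduling_policy n r \<sigma> \<longrightarrow> policy_cost n w M p \<pi> \<le> policy_cost n w M p \<sigma>)"

end

theory Submission imports Defs begin

text \<open>
  Fix a job \<open>j\<close> and let \<open>a\<close> be its \<open>\<alpha>\<close>-point in the preemptive schedule. FIFO service and the
  unit speed of the virtual machine show that \<open>j\<close> completes no later than
  \<open>a + p\<^sub>j + \<Sum>\<^sub>k (p\<^sub>k - (\<eta>\<^sub>k - \<alpha>\<^sub>k) q\<^sub>k)\<^sup>+\<close>, where \<open>\<eta>\<^sub>k\<close> is the fraction of \<open>k\<close> that is virtually
  processed by time \<open>a\<close> and \<open>k\<close> ranges over the jobs with \<open>\<alpha>\<^sub>k \<le> \<eta>\<^sub>k\<close>. By the NBUE property the
  expectation of each summand is at most \<open>q\<^sub>k \<delta> / (\<delta> + \<eta>\<^sub>k - \<alpha>\<^sub>k)\<close>. As a function of \<open>\<alpha>\<^sub>j\<close>, the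
  fraction \<open>\<eta>\<^sub>k\<close> is constant for \<open>k > j\<close> and a monotone 0-1 step function for \<open>k < j\<close>, and so is
  handled by the first and the second condition on \<open>f\<close>, respectively; since
  \<open>a = idle + \<Sum>\<^sub>k q\<^sub>k \<eta>\<^sub>k\<close> with a constant idle time and the mean busy time is the average
  \<open>\<alpha>\<close>-point, this gives \<open>E C\<^sub>j \<le> c (M\<^sub>j + q\<^sub>j / 2)\<close> job by job.

  For the lower bound, a start time \<open>S\<^sub>j\<close> is independent of \<open>p\<^sub>j\<close>, so taking expectations in
  \<open>\<Sum>\<^sub>B p\<^sub>j S\<^sub>j \<ge> l \<Sum>\<^sub>B p\<^sub>j + \<Sum>\<^bsub>i<j\<^esub> p\<^sub>i p\<^sub>j\<close>, valid for every set \<open>B\<close> of jobs not released before \<open>l\<close>, yields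
  a bound on \<open>\<Sum>\<^sub>B q\<^sub>j (E S\<^sub>j + q\<^sub>j / 2)\<close> that the preemptive schedule attains on each busy period of
  each set \<open>{1..i}\<close>. Writing the weights as nonnegative combinations of these prefixes finishes
  the proof.
\<close>

subsection \<open>Work done in the preemptive schedule\<close>

text \<open>The set behind \<open>sp_ind\<close>: work becomes a Lebesgue measure, and the joint
  work on several jobs the measure of a disjoint union.\<close>

definition sp_busy :: "(nat \<Rightarrow> real) \<Rightarrow> (nat \<Rightarrow> real) \<Rightarrow> nat \<Rightarrow> real set" where
  "sp_busy r q j = {t. sp_pending r q j t \<and> (\<forall>k\<in>{1..<j}. \<not> sp_pending r q k t)}"

definition sp_work :: "(nat \<Rightarrow> real) \<Rightarrow> (nat \<Rightarrow> real) \<Rightarrow> nat \<Rightarrow> real \<Rightarrow> real" where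
  "sp_work r q j t = (LBINT s:{0..t}. sp_ind r q j s)"

lemma sp_ind_eq_indicator: "sp_ind r q j = indicator (sp_busy r q j)"
  by (auto simp: sp_ind_def sp_busy_def fun_eq_iff)

lemma sp_busy_sets [measurable]: "sp_busy r q j \<in> sets borel"
proof -
  have "sp_busy r q j = {t. sp_pending r q j t} - (\<Union>k\<in>{1..<j}. {s. sp_pending r q k s})"
    by (auto simp: sp_busy_def)
  then show ?thesis using sets_sp_pending by (auto intro!: sets.Diff sets.finite_UN)
qed

lemma sp_busy_disjoint:
  assumes "i \<noteq> j" "1 \<le> i" "1 \<le> j"
  shows "sp_busy r q i \<inter> sp_busy r q j = {}"
  using assms by (cases "i < j") (auto simp: sp_busy_def)

text \<open>Whenever one of the first \<open>i\<close> jobs is pending, the pending one of smallest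
  index is processed, so jobs of larger index never delay a prefix.\<close>

lemma UN_sp_busy: "(\<Union>k\<in>{1..i}. sp_busy r q k) = {t. \<exists>k\<in>{1..i}. sp_pending r q k t}"
proof (intro equalityI subsetI)
  fix t assume "t \<in> {t. \<exists>k\<in>{1..i}. sp_pending r q k t}"
  then have ex: "\<exists>k. k \<in> {1..i} \<and> sp_pending r q k t" by auto
  define k where "k = (LEAST k. k \<in> {1..i} \<and> sp_pending r q k t)"
  have k: "k \<in> {1..i}" "sp_pending r q k t" using LeastI_ex[OF ex] by (auto simp: k_def)
  have "\<not> sp_pending r q m t" if "m \<in> {1..<k}" for m
    using that k not_less_Least[of m "\<lambda>k. k \<in> {1..i} \<and> sp_pending r q k t", folded k_def]
    by auto
  then show "t \<in> (\<Union>k\<in>{1..i}. sp_busy r q k)" using k by (auto simp: sp_busy_def)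
qed (auto simp: sp_busy_def)

lemma sp_work_eq: "sp_work r q j t = measure lborel (sp_busy r q j \<inter> {0..t})"
proof -
  have "sp_work r q j t = (LBINT s. indicator (sp_busy r q j \<inter> {0..t}) s)"
    unfolding sp_work_def set_lebesgue_integral_def sp_ind_eq_indicator
    by (intro Bochner_Integration.integral_cong) (auto simp: indicator_def)
  then show ?thesis by simp
qed

lemma fmeasurable_Int_Icc:
  fixes a b :: real
  assumes "S \<in> sets borel" "T \<in> sets borel" "T \<subseteq> {a..b}"
  shows "S \<inter> T \<in> fmeasurable lborel"
proof (rule fmeasurableI)
  have "emeasure lborel (S \<inter> T) \<le> emeasure lborel {a..b}"
    using assms by (intro emeasure_mono) auto
  also have "\<dots> < \<infinity>" by (simp add: emeasure_lborel_Icc_eq)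
  finally show "emeasure lborel (S \<inter> T) < \<infinity>" .
qed (use assms in auto)

lemma sp_work_diff:
  assumes "0 \<le> a" "a \<le> b"
  shows "sp_work r q j b - sp_work r q j a = measure lborel (sp_busy r q j \<inter> {a<..b})"
proof -
  have "sp_busy r q j \<inter> {0..b} = (sp_busy r q j \<inter> {0..a}) \<union> (sp_busy r q j \<inter> {a<..b})"
    using assms by auto
  moreover have "measure lborel ((sp_busy r q j \<inter> {0..a}) \<union> (sp_busy r q j \<inter> {a<..b})) =
      measure lborel (sp_busy r q j \<inter> {0..a}) + measure lborel (sp_busy r q j \<inter> {a<..b})"
    using assms by (intro measure_Un_AE fmeasurable_Int_Icc[of _ _ 0 b]) auto
  ultimately show ?thesis by (simp add: sp_work_eq)
qed

lemma sum_sp_work_diff: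
  assumes "0 \<le> a" "a \<le> b" "finite K" "\<And>k. k \<in> K \<Longrightarrow> 1 \<le> k"
  shows "(\<Sum>k\<in>K. sp_work r q k b - sp_work r q k a)
           = measure lborel ((\<Union>k\<in>K. sp_busy r q k) \<inter> {a<..b})"
proof -
  have "disjoint_family_on (\<lambda>k. sp_busy r q k \<inter> {a<..b}) K"
    unfolding disjoint_family_on_def using sp_busy_disjoint assms(4) by blast
  then have "measure lborel (\<Union>k\<in>K. sp_busy r q k \<inter> {a<..b})
      = (\<Sum>k\<in>K. measure lborel (sp_busy r q k \<inter> {a<..b}))"
    using assms fmeasurable_Int_Icc[OF sp_busy_sets, of "{a<..b}" a b]
    by (intro measure_finite_Union) (auto simp: fmeasurable_def less_top[symmetric] subset_eq)
  then show ?thesis using assms by (simp add: sp_work_diff)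
qed

text \<open>Unit speed of the machine: distinct jobs are processed at disjoint times.\<close>

lemma sum_sp_work_diff_le:
  assumes "0 \<le> a" "a \<le> b" "finite K" "\<And>k. k \<in> K \<Longrightarrow> 1 \<le> k"
  shows "(\<Sum>k\<in>K. sp_work r q k b - sp_work r q k a) \<le> b - a"
proof -
  have "measure lborel ((\<Union>k\<in>K. sp_busy r q k) \<inter> {a<..b}) \<le> measure lborel {a..b}"
    using assms by (intro measure_mono_fmeasurable)
      (auto intro!: fmeasurableI simp: emeasure_lborel_Icc_eq)
  then show ?thesis using sum_sp_work_diff[OF assms] assms(2) by simp
qed

text \<open>While one of the first \<open>i\<close> jobs is pending, these jobs together receive the
  whole capacity of the machine.\<close>

lemma sum_sp_work_diff_eq:
  assumes "0 \<le> a" "a \<le> b" "\<And>t. a \<le> t \<Longrightarrow> t < b \<Longrightarrow> \<exists>k\<in>{1..i}. sp_pending r q k t"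
  shows "(\<Sum>k\<in>{1..i}. sp_work r q k b - sp_work r q k a) = b - a"
proof -
  have "measure lborel {a<..<b} \<le> measure lborel ((\<Union>k\<in>{1..i}. sp_busy r q k) \<inter> {a<..b})"
  proof (rule measure_mono_fmeasurable)
    show "{a<..<b} \<subseteq> (\<Union>k\<in>{1..i}. sp_busy r q k) \<inter> {a<..b}"
      unfolding UN_sp_busy using assms(3) by auto
    show "(\<Union>k\<in>{1..i}. sp_busy r q k) \<inter> {a<..b} \<in> fmeasurable lborel"
      by (rule fmeasurable_Int_Icc[of _ _ a b]) auto
  qed simp
  then show ?thesis
    using sum_sp_work_diff[of a b "{1..i}" r q] sum_sp_work_diff_le[of a b "{1..i}" r q] assms
    by simp
qed

lemma sp_work_mono:
  assumes "0 \<le> a" "a \<le> b"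
  shows "sp_work r q j a \<le> sp_work r q j b"
  using sp_work_diff[OF assms, of r q j] measure_nonneg[of lborel] by (smt (verit))

lemma sp_work_lipschitz:
  assumes "0 \<le> a" "a \<le> b"
  shows "sp_work r q j b - sp_work r q j a \<le> b - a"
proof -
  have "measure lborel (sp_busy r q j \<inter> {a<..b}) \<le> measure lborel {a..b}"
    by (intro measure_mono_fmeasurable) (auto intro!: fmeasurableI simp: emeasure_lborel_Icc_eq)
  then show ?thesis using sp_work_diff[OF assms] assms(2) by simp
qed

lemma sp_work_const:
  assumes "0 \<le> a" "a \<le> b" "\<And>t. a \<le> t \<Longrightarrow> t < b \<Longrightarrow> t \<notin> sp_busy r q j"
  shows "sp_work r q j b = sp_work r q j a"
proof -
  \<comment> \<open>The right endpoint may still belong to \<open>sp_busy\<close>, but it is a null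
    set.\<close>
  have "measure lborel (sp_busy r q j \<inter> {a<..b}) \<le> measure lborel {b}"
  proof (rule measure_mono_fmeasurable)
    show "sp_busy r q j \<inter> {a<..b} \<subseteq> {b}"
      using assms(3) by (metis IntE greaterThanAtMost_iff insertI1 less_eq_real_def subsetI)
  qed (auto intro!: fmeasurableI)
  then show ?thesis using sp_work_diff[OF assms(1,2), of r q j] by (simp add: measure_le_0_iff)
qed

lemma sp_work_nonneg: "0 \<le> sp_work r q j t"
  by (simp add: sp_work_eq)

lemma sp_work_nonpos: "t \<le> 0 \<Longrightarrow> sp_work r q j t = 0"
proof -
  assume "t \<le> 0"
  then have "measure lborel (sp_busy r q j \<inter> {0..t}) \<le> measure lborel {0::real}"
    by (intro measure_mono_fmeasurable) (auto intro!: fmeasurableI)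
  then show ?thesis by (simp add: sp_work_eq measure_le_0_iff)
qed

lemma continuous_on_sp_work: "continuous_on {0..} (sp_work r q j)"
proof (rule lipschitz_on_continuous_on[where L=1], rule lipschitz_onI)
  fix a b :: real assume "a \<in> {0..}" "b \<in> {0..}"
  then show "dist (sp_work r q j a) (sp_work r q j b) \<le> 1 * dist a b"
    using sp_work_lipschitz[of a b r q j] sp_work_lipschitz[of b a r q j]
      sp_work_mono[of a b r q j] sp_work_mono[of b a r q j]
    by (cases "a \<le> b") (auto simp: dist_real_def abs_real_def)
qed simp

lemma mono_sp_work: "mono (sp_work r q j)"
  by (rule monoI) (metis sp_work_mono sp_work_nonneg sp_work_nonpos linear)

lemma sp_work_measurable [measurable]: "sp_work r q j \<in> borel_measurable borel"
  by (rule borel_measurable_mono[OF mono_sp_work])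

section \<open>Completion and \<alpha>-points of the jobs\<close>

locale preemptive_schedule =
  fixes n :: nat and r q :: "nat \<Rightarrow> real"
  assumes r_nonneg: "j \<in> {1..n} \<Longrightarrow> 0 \<le> r j"
    and q_pos: "j \<in> {1..n} \<Longrightarrow> 0 < q j"
begin

abbreviation "pending \<equiv> sp_pending r q"
abbreviation "busy \<equiv> sp_busy r q"
abbreviation "work \<equiv> sp_work r q"
abbreviation "apoint \<equiv> alpha_point r q"

lemma pending_iff: "j \<in> {1..n} \<Longrightarrow> pending j t \<longleftrightarrow> r j \<le> t \<and> work j t < q j"
  unfolding sp_work_def by (intro sp_pending_iff r_nonneg q_pos)

lemma work_before_release: "j \<in> {1..n} \<Longrightarrow> t \<le> r j \<Longrightarrow> work j t = 0"
proof (cases "0 \<le> t")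
  case True
  assume "j \<in> {1..n}" "t \<le> r j"
  then have "work j t = work j 0"
    using True by (intro sp_work_const) (auto simp: sp_busy_def pending_iff)
  then show ?thesis by (simp add: sp_work_nonpos)
qed (simp add: sp_work_nonpos)

text \<open>The work is continuous, so before exceeding \<open>q j\<close> it would have to equal
  \<open>q j\<close>; from then on the job is not pending and receives nothing more.\<close>

lemma work_le:
  assumes j: "j \<in> {1..n}"
  shows "work j t \<le> q j"
proof (rule ccontr)
  assume gt: "\<not> work j t \<le> q j"
  then have "0 \<le> t" using q_pos[OF j] sp_work_nonpos[of t r q j] by linarith
  moreover have "continuous_on {0..t} (work j)"
    using continuous_on_sp_work by (rule continuous_on_subset) auto
  ultimately obtain s where s: "0 \<le> s" "s \<le> t" "work j s = q j"
    using IVT'[of "work j" 0 "q j" t] gt q_pos[OF j] sp_work_nonpos[of 0 r q j] by force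
  have "work j t = work j s"
    using s sp_work_mono[of s _ r q j] j
    by (intro sp_work_const) (auto simp: sp_busy_def pending_iff not_less)
  then show False using gt s by simp
qed

lemma pending_persists:
  assumes "j \<in> {1..n}" "r j \<le> s" "s \<le> t" "work j t < q j"
  shows "pending j s"
  using assms sp_work_mono[of s t r q j] r_nonneg[of j] by (auto simp: pending_iff)

lemma work_completes:
  assumes j: "j \<in> {1..n}"
  shows "\<exists>t\<ge>r j. work j t = q j"
proof (rule ccontr)
  \<comment> \<open>The horizon exceeds the total processing requirement by one unit: were
    \<open>j\<close> unfinished at \<open>T\<close>, the machine would be busy throughout
    \<open>[r j, T]\<close> and do more work than all jobs contain.\<close>
  define T where "T = r j + (\<Sum>k\<in>{1..n}. q k) + 1"
  have T: "r j \<le> T" "0 \<le> r j"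
    using r_nonneg[OF j] sum_nonneg[of "{1..n}" q] q_pos[THEN less_imp_le] by (auto simp: T_def)
  assume "\<not> ?thesis"
  then have "work j T < q j" using work_le[OF j, of T] T by force
  then have "(\<Sum>k\<in>{1..n}. work k T - work k (r j)) = T - r j"
    using T j by (intro sum_sp_work_diff_eq) (auto intro!: bexI[of _ j] intro: pending_persists[of j _ T])
  moreover have "(\<Sum>k\<in>{1..n}. work k T - work k (r j)) \<le> (\<Sum>k\<in>{1..n}. q k)"
    by (intro sum_mono) (metis diff_mono diff_zero work_le sp_work_nonneg)
  ultimately show False by (simp add: T_def)
qed

text \<open>Continuity of the work makes the \<open>LEAST\<close> in \<open>alpha_point\<close> an
  attained minimum. By \<open>apoint_le_iff\<close> the \<alpha>-point is the generalized inverse of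
  the monotone work function.\<close>

lemma apoint:
  assumes j: "j \<in> {1..n}" and \<alpha>: "0 \<le> \<alpha>" "\<alpha> \<le> 1"
  shows apoint_nonneg: "0 \<le> apoint j \<alpha>"
    and work_apoint: "work j (apoint j \<alpha>) = \<alpha> * q j"
    and apoint_le_iff: "0 \<le> t \<Longrightarrow> apoint j \<alpha> \<le> t \<longleftrightarrow> \<alpha> * q j \<le> work j t"
proof -
  note q = q_pos[OF j]
  obtain T where T: "T \<ge> r j" "work j T = q j" using work_completes[OF j] by blast
  have T0: "0 \<le> T" using T r_nonneg[OF j] by simp
  have aq: "\<alpha> * q j \<le> q j" "0 \<le> \<alpha> * q j" using \<alpha> q by auto
  have cont: "continuous_on {0..T} (work j)"
    using continuous_on_sp_work by (rule continuous_on_subset) auto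
  \<comment> \<open>This level set of the work is closed, bounded and, by the intermediate value
    theorem, nonempty; so it has a least element.\<close>
  define S where "S = {0..T} \<inter> work j -` {\<alpha> * q j}"
  have "closed S" unfolding S_def by (intro continuous_closed_preimage cont) auto
  then have "compact S" using bounded_subset[of "{0..T}" S] by (auto simp: compact_eq_bounded_closed S_def)
  moreover have "S \<noteq> {}"
    using IVT'[of "work j" 0 "\<alpha> * q j" T] aq T T0 cont sp_work_nonpos[of 0 r q j] by (force simp: S_def)
  ultimately obtain s where s: "s \<in> S" and smin: "\<And>t. t \<in> S \<Longrightarrow> s \<le> t"
    using compact_attains_inf by metis
  have sle: "s \<le> t" if "0 \<le> t" "\<alpha> * q j \<le> work j t" for t
  proof (rule ccontr)
    assume "\<not> s \<le> t"
    then have "t < s" by simp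
    then have "work j t = \<alpha> * q j" using that s sp_work_mono[of t s r q j] by (auto simp: S_def)
    then have "t \<in> S" using that \<open>t < s\<close> s by (auto simp: S_def)
    then show False using smin \<open>t < s\<close> by force
  qed
  have eq: "apoint j \<alpha> = s"
    unfolding alpha_point_def sp_work_def[symmetric]
    by (rule Least_equality) (use s sle in \<open>auto simp: S_def\<close>)
  show "0 \<le> apoint j \<alpha>" "work j (apoint j \<alpha>) = \<alpha> * q j" using s by (auto simp: eq S_def)
  show "apoint j \<alpha> \<le> t \<longleftrightarrow> \<alpha> * q j \<le> work j t" if "0 \<le> t"
    using sle[OF that] s sp_work_mono[of s t r q j] by (auto simp: eq S_def)
qed

lemma apoint_mono:
  assumes "j \<in> {1..n}" "0 \<le> \<alpha>" "\<alpha> \<le> \<beta>" "\<beta> \<le> 1"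
  shows "apoint j \<alpha> \<le> apoint j \<beta>"
  using assms apoint_nonneg[of j \<beta>] work_apoint[of j \<beta>] q_pos[of j]
  by (subst apoint_le_iff) (auto intro: mult_right_mono)

lemma release_less_apoint:
  assumes "j \<in> {1..n}" "0 < \<alpha>" "\<alpha> \<le> 1"
  shows "r j < apoint j \<alpha>"
proof (rule ccontr)
  assume "\<not> ?thesis"
  then have "work j (apoint j \<alpha>) = 0" using assms by (intro work_before_release) auto
  then show False using assms work_apoint[of j \<alpha>] q_pos[of j] by auto
qed

lemma pending_between_apoints:
  assumes "j \<in> {1..n}" "0 < \<alpha>" "\<alpha> \<le> 1" "apoint j \<alpha> \<le> t" "t < apoint j 1"
  shows "pending j t"
proof -
  have "0 \<le> t" using assms apoint_nonneg[of j \<alpha>] by auto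
  then have "work j t < q j" using assms apoint_le_iff[of j 1 t] by auto
  then show ?thesis using assms release_less_apoint[of j \<alpha>] by (auto simp: pending_iff)
qed

text \<open>From its \<alpha>-point until its completion \<open>j\<close> is pending, which blocks
  every job of larger index.\<close>

lemma work_apoint_lower_priority:
  assumes "j \<in> {1..n}" "j < k" "0 < \<alpha>" "\<alpha> \<le> 1"
  shows "work k (apoint j \<alpha>) = work k (apoint j 1)"
  using assms apoint_mono[of j \<alpha> 1] apoint_nonneg[of j \<alpha>] pending_between_apoints[of j \<alpha>]
  by (intro sp_work_const[symmetric]) (auto simp: sp_busy_def intro!: bexI[of _ j])

text \<open>A job that has priority over \<open>j\<close> and is released before an \<open>\<alpha>\<close>-point of \<open>j\<close> is
  finished there, since \<open>j\<close> is processed immediately before that point.\<close>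

lemma work_apoint_higher_priority:
  assumes "j \<in> {1..n}" "k \<in> {1..<j}" "0 < \<alpha>" "\<alpha> \<le> 1"
  shows "work k (apoint j \<alpha>) = 0 \<or> work k (apoint j \<alpha>) = q k"
proof (cases "apoint j \<alpha> \<le> r k")
  case True
  then show ?thesis using assms by (intro disjI1 work_before_release) auto
next
  case False
  have k: "k \<in> {1..n}" using assms by auto
  have "\<not> work k (apoint j \<alpha>) < q k"
  proof
    assume lt: "work k (apoint j \<alpha>) < q k"
    \<comment> \<open>An unfinished \<open>k\<close> blocks \<open>j\<close> from \<open>r k\<close>
      on, so the \<alpha>-point of \<open>j\<close> would have been reached by \<open>r k\<close>
      already.\<close>
    have "work j (apoint j \<alpha>) = work j (r k)"
      using False assms r_nonneg[OF k] pending_persists[OF k _ _ lt]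
      by (intro sp_work_const) (auto simp: sp_busy_def intro!: bexI[of _ k])
    then have "apoint j \<alpha> \<le> r k"
      using assms work_apoint[of j \<alpha>] r_nonneg[OF k] by (subst apoint_le_iff) auto
    then show False using False by simp
  qed
  then show ?thesis using work_le[OF k, of "apoint j \<alpha>"] by simp
qed

definition idle_before :: "nat \<Rightarrow> real" where
  "idle_before j = apoint j 1 - (\<Sum>k\<in>{1..n}. work k (apoint j 1))"

lemma idle_before_nonneg: "j \<in> {1..n} \<Longrightarrow> 0 \<le> idle_before j"
  using sum_sp_work_diff_le[of 0 "apoint j 1" "{1..n}" r q] apoint_nonneg[of j 1]
  by (auto simp: idle_before_def sp_work_nonpos)

text \<open>Between any two of its \<alpha>-points \<open>j\<close> is pending and the machine does
  not idle, so the idle time read off at the completion of \<open>j\<close> serves for every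
  \<alpha>.\<close>

lemma apoint_decomp:
  assumes "j \<in> {1..n}" "0 < \<alpha>" "\<alpha> \<le> 1"
  shows "apoint j \<alpha> = idle_before j + (\<Sum>k\<in>{1..n}. work k (apoint j \<alpha>))"
proof -
  have "(\<Sum>k\<in>{1..n}. work k (apoint j 1) - work k (apoint j \<alpha>)) = apoint j 1 - apoint j \<alpha>"
    using assms apoint_mono[of j \<alpha> 1] apoint_nonneg[of j \<alpha>] pending_between_apoints[of j \<alpha>]
    by (intro sum_sp_work_diff_eq) (auto intro!: bexI[of _ j])
  then show ?thesis by (simp add: idle_before_def sum_subtractf)
qed

lemma busy_subset:
  assumes "j \<in> {1..n}"
  shows "busy j \<subseteq> {r j..<apoint j 1}"
proof
  fix t assume "t \<in> busy j"
  then have t: "r j \<le> t" "work j t < q j" using assms by (auto simp: sp_busy_def pending_iff)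
  then show "t \<in> {r j..<apoint j 1}"
    using assms r_nonneg[OF assms] apoint_le_iff[OF assms, of 1 t] by auto
qed

section \<open>Mean busy times as average \<alpha>-points\<close>

lemma emeasure_busy_after:
  assumes "j \<in> {1..n}" "0 \<le> s"
  shows "emeasure lborel (busy j \<inter> {s<..}) = ennreal (q j - work j s)"
proof -
  define T where "T = max s (apoint j 1)"
  have "work j T \<ge> q j"
    using assms sp_work_mono[of "apoint j 1" T r q j] apoint_nonneg[of j 1] work_apoint[of j 1]
    by (auto simp: T_def)
  then have "work j T = q j" using work_le[OF assms(1), of T] by simp
  moreover have "busy j \<inter> {s<..} = busy j \<inter> {s<..T}"
    using busy_subset[OF assms(1)] by (auto simp: T_def)
  moreover have "emeasure lborel (busy j \<inter> {s<..T}) = ennreal (measure lborel (busy j \<inter> {s<..T}))"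
    using fmeasurable_Int_Icc[of "busy j" "{s<..T}" s T]
    by (intro emeasure_eq_ennreal_measure) (auto simp: fmeasurable_def subset_eq)
  ultimately show ?thesis using sp_work_diff[of s T r q j] assms by (simp add: T_def)
qed

text \<open>Fubini after writing \<open>t\<close> as the length of \<open>{0..<t}\<close>; the inner
  integral is the work still to be done on \<open>j\<close> after \<open>s\<close>.\<close>

lemma nn_integral_busy_time:
  assumes j: "j \<in> {1..n}"
  shows "(\<integral>\<^sup>+t. ennreal t * indicator (busy j) t \<partial>lborel)
       = (\<integral>\<^sup>+s. ennreal (q j - work j s) * indicator {0..} s \<partial>lborel)"
proof -
  have pos: "0 \<le> t" if "t \<in> busy j" for t
    using that busy_subset[OF j] r_nonneg[OF j] by force
  have "(\<integral>\<^sup>+t. ennreal t * indicator (busy j) t \<partial>lborel)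
      = (\<integral>\<^sup>+t. (\<integral>\<^sup>+s. indicator (busy j) t * indicator {s. 0 \<le> s \<and> s < t} s \<partial>lborel) \<partial>lborel)"
  proof (intro nn_integral_cong)
    fix t :: real
    have "{s. 0 \<le> s \<and> s < t} = {0..<t}" by auto
    then show "ennreal t * indicator (busy j) t
        = (\<integral>\<^sup>+s. indicator (busy j) t * indicator {s. 0 \<le> s \<and> s < t} s \<partial>lborel)"
      using pos by (cases "t \<in> busy j") simp_all
  qed
  also have "\<dots> = (\<integral>\<^sup>+s. (\<integral>\<^sup>+t. indicator (busy j) t * indicator {s. 0 \<le> s \<and> s < t} s \<partial>lborel) \<partial>lborel)"
    by (rule lborel_pair.Fubini') measurable
  also have "\<dots> = (\<integral>\<^sup>+s. ennreal (q j - work j s) * indicator {0..} s \<partial>lborel)"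
  proof (intro nn_integral_cong)
    fix s :: real
    have "(\<integral>\<^sup>+t. indicator (busy j) t * indicator {s. 0 \<le> s \<and> s < t} s \<partial>lborel)
        = (\<integral>\<^sup>+t. indicator (busy j \<inter> {s<..}) t * indicator {0..} s \<partial>lborel)"
      by (intro nn_integral_cong) (auto simp: indicator_def)
    also have "\<dots> = emeasure lborel (busy j \<inter> {s<..}) * indicator {0..} s"
      by (subst nn_integral_multc) auto
    also have "\<dots> = ennreal (q j - work j s) * indicator {0..} s"
      using emeasure_busy_after[OF j, of s] by (auto simp: indicator_def)
    finally show "(\<integral>\<^sup>+t. indicator (busy j) t * indicator {s. 0 \<le> s \<and> s < t} s \<partial>lborel) = \<dots>" .
  qed
  finally show ?thesis .
qed

text \<open>The \<alpha>-point is the length of the set of times \<open>s\<close> with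
  \<open>work j s < \<alpha> * q j\<close>. Exchanging the integrals leaves, for each
  \<open>s\<close>, the length of the range of \<alpha> not yet reached.\<close>

lemma nn_integral_apoint:
  assumes j: "j \<in> {1..n}"
  shows "ennreal (q j) * (\<integral>\<^sup>+\<alpha>. ennreal (apoint j \<alpha>) * indicator {0<..1} \<alpha> \<partial>lborel)
       = (\<integral>\<^sup>+s. ennreal (q j - work j s) * indicator {0..} s \<partial>lborel)"
proof -
  note q = q_pos[OF j]
  have "(\<integral>\<^sup>+\<alpha>. ennreal (apoint j \<alpha>) * indicator {0<..1} \<alpha> \<partial>lborel)
      = (\<integral>\<^sup>+\<alpha>. (\<integral>\<^sup>+s. indicator {s. 0 \<le> s \<and> work j s < \<alpha> * q j \<and> 0 < \<alpha> \<and> \<alpha> \<le> 1} s \<partial>lborel) \<partial>lborel)"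
  proof (intro nn_integral_cong)
    fix \<alpha> :: real
    show "ennreal (apoint j \<alpha>) * indicator {0<..1} \<alpha>
        = (\<integral>\<^sup>+s. indicator {s. 0 \<le> s \<and> work j s < \<alpha> * q j \<and> 0 < \<alpha> \<and> \<alpha> \<le> 1} s \<partial>lborel)"
    proof (cases "0 < \<alpha> \<and> \<alpha> \<le> 1")
      case True
      then have "{s. 0 \<le> s \<and> work j s < \<alpha> * q j \<and> 0 < \<alpha> \<and> \<alpha> \<le> 1} = {0..<apoint j \<alpha>}"
        using apoint_le_iff[OF j, of \<alpha>] by (force simp: not_less[symmetric])
      then show ?thesis using True apoint_nonneg[OF j, of \<alpha>] by simp
    qed auto
  qed
  also have "\<dots> = (\<integral>\<^sup>+s. (\<integral>\<^sup>+\<alpha>. indicator {s. 0 \<le> s \<and> work j s < \<alpha> * q j \<and> 0 < \<alpha> \<and> \<alpha> \<le> 1} s \<partial>lborel) \<partial>lborel)"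
    by (rule lborel_pair.Fubini') measurable
  also have "\<dots> = (\<integral>\<^sup>+s. ennreal (1 - work j s / q j) * indicator {0..} s \<partial>lborel)"
  proof (intro nn_integral_cong)
    fix s :: real
    have le: "0 \<le> work j s / q j" "work j s / q j \<le> 1"
      using q work_le[OF j, of s] sp_work_nonneg[of r q j s] by auto
    have "(\<integral>\<^sup>+\<alpha>. indicator {s. 0 \<le> s \<and> work j s < \<alpha> * q j \<and> 0 < \<alpha> \<and> \<alpha> \<le> 1} s \<partial>lborel)
        = (\<integral>\<^sup>+\<alpha>. indicator {work j s / q j<..1} \<alpha> * indicator {0..} s \<partial>lborel)"
    proof (intro nn_integral_cong)
      fix \<alpha> :: real
      have "work j s < \<alpha> * q j \<and> 0 < \<alpha> \<longleftrightarrow> work j s / q j < \<alpha>"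
        using q le by (auto simp: pos_divide_less_eq intro: order.strict_trans1)
      then show "indicator {s. 0 \<le> s \<and> work j s < \<alpha> * q j \<and> 0 < \<alpha> \<and> \<alpha> \<le> 1} s
          = (indicator {work j s / q j<..1} \<alpha> * indicator {0..} s :: ennreal)"
        by (auto simp: indicator_def)
    qed
    also have "\<dots> = ennreal (1 - work j s / q j) * indicator {0..} s"
      using le by (subst nn_integral_multc) auto
    finally show "(\<integral>\<^sup>+\<alpha>. indicator {s. 0 \<le> s \<and> work j s < \<alpha> * q j \<and> 0 < \<alpha> \<and> \<alpha> \<le> 1} s \<partial>lborel) = \<dots>" .
  qed
  also have "ennreal (q j) * \<dots> = (\<integral>\<^sup>+s. ennreal (q j - work j s) * indicator {0..} s \<partial>lborel)"
  proof (subst nn_integral_cmult[symmetric])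
    have "ennreal (q j) * ennreal (1 - work j s / q j) = ennreal (q j - work j s)" for s
      using q by (simp add: ennreal_mult'[symmetric] right_diff_distrib)
    then show "(\<integral>\<^sup>+s. ennreal (q j) * (ennreal (1 - work j s / q j) * indicator {0..} s) \<partial>lborel)
        = (\<integral>\<^sup>+s. ennreal (q j - work j s) * indicator {0..} s \<partial>lborel)"
      by (simp add: mult.assoc[symmetric])
  qed measurable
  finally show ?thesis .
qed

text \<open>Links the nonnegative integral to the Bochner integral in
  \<open>sp_mean_busy_time\<close>; integrability holds because \<open>j\<close> is processed within
  a bounded period.\<close>

lemma nn_integral_busy_eq_mean_busy_time:
  assumes j: "j \<in> {1..n}"
  shows "(\<integral>\<^sup>+t. ennreal t * indicator (busy j) t \<partial>lborel) = ennreal (q j * sp_mean_busy_time r q j)"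
    and "0 \<le> sp_mean_busy_time r q j"
proof -
  note q = q_pos[OF j]
  have sub: "t \<in> busy j \<Longrightarrow> 0 \<le> t \<and> t \<le> apoint j 1" for t
    using busy_subset[OF j] r_nonneg[OF j] by force
  have eq: "(LBINT t:{0..}. sp_ind r q j t * t) = (LBINT t. t * indicator (busy j) t)"
    unfolding set_lebesgue_integral_def sp_ind_eq_indicator
    using sub by (intro Bochner_Integration.integral_cong) (auto simp: indicator_def)
  have int: "integrable lborel (\<lambda>t. t * indicator (busy j) t)"
  proof (rule Bochner_Integration.integrable_bound)
    show "integrable lborel (\<lambda>t. apoint j 1 * indicator {0..apoint j 1} t)"
      by (intro integrable_mult_right integrable_real_indicator) (auto simp: emeasure_lborel_Icc_eq)
  qed (use sub in \<open>auto simp: indicator_def\<close>)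
  have "(\<integral>\<^sup>+t. ennreal t * indicator (busy j) t \<partial>lborel) = (\<integral>\<^sup>+t. ennreal (t * indicator (busy j) t) \<partial>lborel)"
    by (intro nn_integral_cong) (auto simp: indicator_def)
  also have "\<dots> = ennreal (LBINT t. t * indicator (busy j) t)"
    using sub by (intro nn_integral_eq_integral int) (auto simp: indicator_def)
  finally show "(\<integral>\<^sup>+t. ennreal t * indicator (busy j) t \<partial>lborel) = ennreal (q j * sp_mean_busy_time r q j)"
    using q by (simp add: sp_mean_busy_time_def eq)
  have "0 \<le> (LBINT t. t * indicator (busy j) t)"
    using sub by (intro Bochner_Integration.integral_nonneg) (auto simp: indicator_def)
  then show "0 \<le> sp_mean_busy_time r q j" using q by (simp add: sp_mean_busy_time_def eq)
qed

text \<open>Multiplied by \<open>q j\<close>, both sides are the integral over time of the remaining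
  work \<open>q j - work j s\<close>.\<close>

lemma nn_integral_apoint_eq_mean_busy_time:
  assumes j: "j \<in> {1..n}"
  shows "(\<integral>\<^sup>+\<alpha>. ennreal (apoint j \<alpha>) * indicator {0<..1} \<alpha> \<partial>lborel) = ennreal (sp_mean_busy_time r q j)"
proof -
  have "ennreal (q j) * (\<integral>\<^sup>+\<alpha>. ennreal (apoint j \<alpha>) * indicator {0<..1} \<alpha> \<partial>lborel)
      = ennreal (q j) * ennreal (sp_mean_busy_time r q j)"
    using nn_integral_apoint[OF j] nn_integral_busy_time[OF j]
      nn_integral_busy_eq_mean_busy_time[OF j] q_pos[OF j] by (simp add: ennreal_mult)
  then show ?thesis using q_pos[OF j] by (subst (asm) ennreal_mult_cancel_left) auto
qed

end

subsection \<open>FIFO service and excess processing times\<close>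

text \<open>Either the server never waits between \<open>T\<close> and the start of
  \<open>j\<close>, which gives the first term of the maximum, or it waits for some job
  \<open>i\<close> for the last time. From \<open>a i\<close> on the queue is then served back to
  back, and the budget hypothesis at \<open>s = a i\<close> trades \<open>a j - a i\<close> against
  the \<open>v k\<close>: only the excess of \<open>x k\<close> over \<open>v k\<close> delays
  \<open>j\<close> beyond \<open>a j\<close>.\<close>

lemma fifo_completion_le:
  assumes "sorted (map a js)" "distinct js" "j \<in> set js"
    and "\<And>k. k \<in> set js \<Longrightarrow> 0 \<le> x k" "\<And>k. k \<in> set js \<Longrightarrow> 0 \<le> a k"
    and "\<And>K s. K \<subseteq> set js \<Longrightarrow> 0 \<le> s \<Longrightarrow> s \<le> a j \<Longrightarrow> (\<And>k. k \<in> K \<Longrightarrow> s \<le> a k \<and> a k \<le> a j)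
           \<Longrightarrow> sum v K \<le> a j - s"
  defines "K \<equiv> \<lambda>js. {k \<in> set js. k \<noteq> j \<and> a k \<le> a j}"
  shows "fifo_completion a x T js j
           \<le> x j + max (T + sum x (K js)) (a j + (\<Sum>k\<in>K js. max 0 (x k - v k)))"
  using assms(1-6)
proof (induction js arbitrary: T)
  case (Cons i js)
  have Kpos: "0 \<le> sum x (K js')" "0 \<le> (\<Sum>k\<in>K js'. max 0 (x k - v k))"
    if "set js' \<subseteq> set (i # js)" for js'
    using that Cons.prems(4) by (auto intro!: sum_nonneg simp: K_def)
  show ?case
  proof (cases "i = j")
    case True
    have "max T (a j) \<le> max (T + sum x (K (i # js))) (a j + (\<Sum>k\<in>K (i # js). max 0 (x k - v k)))"
      using Kpos[of "i # js"] by (intro max.mono) auto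
    then show ?thesis using True by (simp add: Let_def)
  next
    case False
    then have j: "j \<in> set js" using Cons.prems by simp
    have aij: "a i \<le> a j" using Cons.prems(1) j by auto
    have fin: "finite (K js)" by (simp add: K_def)
    have K: "K (i # js) = insert i (K js)" "i \<notin> K js"
      using False aij Cons.prems(2) by (auto simp: K_def)
    define T' where "T' = max T (a i) + x i"
    have IH: "fifo_completion a x T' js j
        \<le> x j + max (T' + sum x (K js)) (a j + (\<Sum>k\<in>K js. max 0 (x k - v k)))"
      using Cons.prems j by (intro Cons.IH) (auto simp: subset_insertI2)
    \<comment> \<open>The list is sorted by entry time, so every job counted in
      \<open>K (i # js)\<close> enters in the window from \<open>a i\<close> to
      \<open>a j\<close>.\<close>
    have "sum v (K (i # js)) \<le> a j - a i"
      using Cons.prems(1) aij Cons.prems(5)[of i] by (intro Cons.prems(6)) (auto simp: K_def)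
    then have "a i + sum x (K (i # js)) \<le> a j + (\<Sum>k\<in>K (i # js). x k - v k)"
      by (simp add: sum_subtractf)
    also have "\<dots> \<le> a j + (\<Sum>k\<in>K (i # js). max 0 (x k - v k))"
      by (intro add_left_mono sum_mono) simp
    finally have *: "a i + x i + sum x (K js) \<le> a j + (\<Sum>k\<in>K (i # js). max 0 (x k - v k))"
      using K fin by simp
    have **: "(\<Sum>k\<in>K js. max 0 (x k - v k)) \<le> (\<Sum>k\<in>K (i # js). max 0 (x k - v k))"
      using K fin by simp
    \<comment> \<open>The maximum in \<open>T'\<close> decides: \<open>T\<close> leads to the first
      term of the bound, \<open>a i\<close> is absorbed by the second.\<close>
    have "T' + sum x (K js) \<le> max (T + sum x (K (i # js))) (a j + (\<Sum>k\<in>K (i # js). max 0 (x k - v k)))"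
      using * K fin by (auto simp: T'_def max_def)
    then have "fifo_completion a x T' js j
        \<le> x j + max (T + sum x (K (i # js))) (a j + (\<Sum>k\<in>K (i # js). max 0 (x k - v k)))"
      using IH ** by linarith
    then show ?thesis using False by (simp add: Let_def T'_def)
  qed
qed simp

text \<open>Markov's inequality in the form \<open>t \<cdot> 1[X > t] \<le> min X t\<close> suffices: no differential
  inequality for the integrated tail is needed.\<close>

lemma delta_NBUE_excess:
  assumes "prob_space M" "integrable M X" "AE \<omega> in M. 0 \<le> X \<omega>" "delta_NBUE M \<delta> X"
    and "0 < \<delta>" "0 \<le> t" and \<mu>: "\<mu> = (LINT \<omega>|M. X \<omega>)" "0 < \<mu>"
  shows "(LINT \<omega>|M. max 0 (X \<omega> - t)) \<le> \<mu> * (\<delta> / (\<delta> + t / \<mu>))"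
proof -
  interpret prob_space M by fact
  have [measurable]: "X \<in> borel_measurable M" using assms(2) by auto
  define A where "A = {\<omega> \<in> space M. X \<omega> > t}"
  have A [measurable]: "A \<in> sets M" unfolding A_def by measurable
  define g where "g = (LINT \<omega>|M. max 0 (X \<omega> - t))"
  have int: "integrable M (\<lambda>\<omega>. max 0 (X \<omega> - t))" using assms(2) by auto
  have g: "g = (LINT \<omega>:A|M. X \<omega> - t)"
    unfolding g_def set_lebesgue_integral_def
    by (intro Bochner_Integration.integral_cong) (auto simp: A_def indicator_def)
  \<comment> \<open>\<open>delta_NBUE\<close> constrains only tails of positive probability; on a
    null tail the excess vanishes.\<close>
  have tail: "g \<le> \<delta> * \<mu> * prob A"
  proof (cases "prob A > 0")
    case True
    then show ?thesis
      using assms(4,6) unfolding delta_NBUE_def A_def[symmetric] g \<mu>(1)[symmetric]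
      by (auto simp: A_def pos_divide_le_eq)
  next
    case False
    then have "prob A = 0" using measure_nonneg[of M A] by linarith
    then have "AE \<omega> in M. \<omega> \<notin> A" using prob_eq_0[OF A] by simp
    then have "g = 0" unfolding g set_lebesgue_integral_def
      by (intro integral_eq_zero_AE) auto
    then show ?thesis using \<open>prob A = 0\<close> by simp
  qed
  have "g + t * prob A = (LINT \<omega>|M. max 0 (X \<omega> - t) + t * indicator A \<omega>)"
    using int by (subst Bochner_Integration.integral_add) (auto simp: g_def emeasure_eq_measure)
  also have "\<dots> \<le> (LINT \<omega>|M. X \<omega>)"
  proof (intro integral_mono_AE Bochner_Integration.integrable_add)
    show "AE \<omega> in M. max 0 (X \<omega> - t) + t * indicator A \<omega> \<le> X \<omega>"
      using assms(3) AE_space by eventually_elim (auto simp: A_def indicator_def)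
  qed (use int assms(2) in \<open>auto simp: emeasure_eq_measure\<close>)
  finally have "g + t * prob A \<le> \<mu>" using \<mu> by simp
  \<comment> \<open>Eliminates \<open>prob A\<close>: the tail estimate bounds it from below by
    \<open>g / (\<delta> * \<mu>)\<close>, which leaves an inequality for \<open>g\<close>
    alone.\<close>
  moreover have "t * (g / (\<delta> * \<mu>)) \<le> t * prob A"
    using tail assms \<mu>(2) by (intro mult_left_mono) (auto simp: divide_le_eq mult_ac)
  ultimately have "g * (1 + t / (\<delta> * \<mu>)) \<le> \<mu>" by (simp add: algebra_simps)
  then have "g \<le> \<mu> / (1 + t / (\<delta> * \<mu>))"
    using assms \<mu>(2) by (subst pos_le_divide_eq) (auto simp: add_pos_nonneg)
  also have "\<dots> = \<mu> * (\<delta> / (\<delta> + t / \<mu>))"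
  proof -
    have "\<delta> + t / \<mu> = \<delta> * (1 + t / (\<delta> * \<mu>))" using assms(5) \<mu>(2) by (simp add: field_simps)
    then show ?thesis using assms(5) by simp
  qed
  finally show ?thesis by (simp add: g_def)
qed

text \<open>In the lower bound \<open>l\<close> is the start of a busy period and \<open>Q\<close>
  bounds its length; \<open>l = 0\<close> and \<open>Q = 1\<close> give the mean of a uniform
  \<alpha>.\<close>

lemma nn_integral_Icc_id:
  assumes "0 \<le> l" "0 \<le> Q"
  shows "(\<integral>\<^sup>+t. ennreal t * indicator {l..l + Q} t \<partial>lborel) = ennreal (l * Q + Q\<^sup>2 / 2)"
proof -
  have "(\<integral>\<^sup>+t. ennreal t * indicator {l..l + Q} t \<partial>lborel) = ennreal ((l + Q)\<^sup>2 / 2 - l\<^sup>2 / 2)"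
    using assms by (intro nn_integral_FTC_Icc[where F="\<lambda>x. x\<^sup>2 / 2"]) (auto intro!: derivative_eq_intros)
  also have "(l + Q)\<^sup>2 / 2 - l\<^sup>2 / 2 = l * Q + Q\<^sup>2 / 2" by (simp add: power2_eq_square field_simps)
  finally show ?thesis .
qed

lemma nn_integral_PiM_component:
  assumes "prob_space D" "finite I" "j \<in> I" and [measurable]: "g \<in> borel_measurable D"
  shows "(\<integral>\<^sup>+\<alpha>. g (\<alpha> j) \<partial>PiM I (\<lambda>_. D)) = (\<integral>\<^sup>+a. g a \<partial>D)"
proof -
  interpret D: prob_space D by fact
  interpret product_prob_space "\<lambda>_. D" I by standard
  have "(\<integral>\<^sup>+a. g a \<partial>distr (PiM I (\<lambda>_. D)) D (\<lambda>\<alpha>. \<alpha> j)) = (\<integral>\<^sup>+\<alpha>. g (\<alpha> j) \<partial>PiM I (\<lambda>_. D))"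
    using assms(3) by (intro nn_integral_distr) auto
  then show ?thesis using assms(3) by (simp add: PiM_component)
qed

lemma nn_integral_PiM_two_components:
  assumes "prob_space D" "finite I" "j \<in> I" "k \<in> I" "j \<noteq> k"
    and g [measurable]: "(\<lambda>(a, b). g a b) \<in> borel_measurable (D \<Otimes>\<^sub>M D)"
  shows "(\<integral>\<^sup>+\<alpha>. g (\<alpha> j) (\<alpha> k) \<partial>PiM I (\<lambda>_. D)) = (\<integral>\<^sup>+a. \<integral>\<^sup>+b. g a b \<partial>D \<partial>D)"
proof -
  interpret D: prob_space D by fact
  interpret product_sigma_finite "\<lambda>_. D" by standard
  define J where "J = I - {k}"
  have J: "finite J" "k \<notin> J" "j \<in> J" "I = insert k J" using assms by (auto simp: J_def)
  have [measurable]: "j \<in> J" by fact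
  have "(\<integral>\<^sup>+\<alpha>. g (\<alpha> j) (\<alpha> k) \<partial>PiM I (\<lambda>_. D))
      = (\<integral>\<^sup>+\<alpha>. \<integral>\<^sup>+b. g ((\<alpha>(k := b)) j) ((\<alpha>(k := b)) k) \<partial>D \<partial>PiM J (\<lambda>_. D))"
    unfolding J(4) using J by (intro product_nn_integral_insert) measurable
  also have "\<dots> = (\<integral>\<^sup>+\<alpha>. \<integral>\<^sup>+b. g (\<alpha> j) b \<partial>D \<partial>PiM J (\<lambda>_. D))"
    using assms(5) by simp
  also have "\<dots> = (\<integral>\<^sup>+a. \<integral>\<^sup>+b. g a b \<partial>D \<partial>D)"
    using J by (intro nn_integral_PiM_component[OF assms(1), of J j "\<lambda>a. \<integral>\<^sup>+b. g a b \<partial>D"]) measurable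
  finally show ?thesis .
qed

context preemptive_schedule
begin

text \<open>An instance of \<open>fifo_completion_le\<close> with \<open>v k\<close> the virtual
  work on \<open>k\<close> between its entry into the queue and \<open>C\<close>. The unit speed of
  the virtual machine supplies the budget hypothesis.\<close>

lemma rsos_completion_le:
  assumes j: "j \<in> {1..n}" and \<alpha>: "\<And>k. k \<in> {1..n} \<Longrightarrow> \<alpha> k \<in> {0<..1}"
    and x: "\<And>k. k \<in> {1..n} \<Longrightarrow> 0 \<le> x k"
  defines "C \<equiv> apoint j (\<alpha> j)"
  shows "rsos_completion n r q \<alpha> x j \<le> C + x j + (\<Sum>k\<in>{1..n} - {j}.
           if \<alpha> k * q k \<le> work k C then max 0 (x k - (work k C - \<alpha> k * q k)) else 0)"
proof -
  define a where "a = (\<lambda>k. apoint k (\<alpha> k))"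
  define js where "js = sort_key a [1..<Suc n]"
  define v where "v = (\<lambda>k. work k C - \<alpha> k * q k)"
  define K where "K = {k \<in> set js. k \<noteq> j \<and> a k \<le> a j}"
  have set: "set js = {1..n}" by (simp add: js_def atLeastLessThanSuc_atLeastAtMost del: upt_Suc)
  have a0: "0 \<le> a k" if "k \<in> {1..n}" for k
    using that \<alpha>[OF that] by (auto simp: a_def intro!: apoint_nonneg)
  have wa: "work k (a k) = \<alpha> k * q k" if "k \<in> {1..n}" for k
    using that \<alpha>[OF that] by (auto simp: a_def intro!: work_apoint)
  have aC: "a j = C" by (simp add: a_def C_def)
  have v: "sum v L \<le> a j - s"
    if "L \<subseteq> {1..n}" "0 \<le> s" "s \<le> a j" "\<And>k. k \<in> L \<Longrightarrow> s \<le> a k \<and> a k \<le> a j" for L s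
  proof -
    have "sum v L \<le> (\<Sum>k\<in>L. work k (a j) - work k s)"
    proof (rule sum_mono)
      fix k assume "k \<in> L"
      then show "v k \<le> work k (a j) - work k s"
        using that wa[of k] sp_work_mono[of s "a k" r q k] by (auto simp: v_def aC)
    qed
    also have "\<dots> \<le> a j - s"
      using that finite_subset[OF that(1)] by (intro sum_sp_work_diff_le) auto
    finally show ?thesis .
  qed
  have K: "K \<subseteq> {1..n}" unfolding K_def set by blast
  have "fifo_completion a x 0 js j
      \<le> x j + max (0 + sum x K) (a j + (\<Sum>k\<in>K. max 0 (x k - v k)))"
    unfolding K_def
  proof (rule fifo_completion_le)
    show "sorted (map a js)" "distinct js" by (simp_all add: js_def del: upt_Suc)
  qed (use j x a0 v in \<open>auto simp: set\<close>)
  \<comment> \<open>The machine is free from time 0, and the budget at \<open>s = 0\<close> makes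
    the second term of the maximum dominate.\<close>
  also have "0 + sum x K \<le> a j + (\<Sum>k\<in>K. max 0 (x k - v k))"
  proof -
    have "sum v K \<le> a j - 0"
      using K a0 j by (intro v) (auto simp: K_def)
    then have "sum x K \<le> a j + (\<Sum>k\<in>K. x k - v k)" by (simp add: sum_subtractf)
    also have "\<dots> \<le> a j + (\<Sum>k\<in>K. max 0 (x k - v k))"
      by (intro add_left_mono sum_mono) simp
    finally show ?thesis by simp
  qed
  then have "max (0 + sum x K) (a j + (\<Sum>k\<in>K. max 0 (x k - v k)))
      = a j + (\<Sum>k\<in>K. max 0 (x k - v k))" by simp
  also have "(\<Sum>k\<in>K. max 0 (x k - v k)) = (\<Sum>k\<in>{1..n} - {j}.
      if \<alpha> k * q k \<le> work k C then max 0 (x k - (work k C - \<alpha> k * q k)) else 0)"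
  proof -
    \<comment> \<open>Job \<open>k\<close> enters no later than \<open>j\<close> precisely if the
      fraction \<open>\<alpha> k\<close> of it is virtually processed by time
      \<open>C\<close>.\<close>
    have "K = {k \<in> {1..n} - {j}. \<alpha> k * q k \<le> work k C}"
    proof -
      have "a k \<le> a j \<longleftrightarrow> \<alpha> k * q k \<le> work k C" if "k \<in> {1..n}" for k
        using \<alpha>[OF that] that a0[OF j] unfolding aC[symmetric] by (subst a_def, subst apoint_le_iff) auto
      then show ?thesis unfolding K_def set by auto
    qed
    then show ?thesis by (simp add: v_def sum.inter_filter[symmetric])
  qed
  finally have "fifo_completion a x 0 js j \<le> x j + (a j + (\<Sum>k\<in>{1..n} - {j}.
      if \<alpha> k * q k \<le> work k C then max 0 (x k - (work k C - \<alpha> k * q k)) else 0))" .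
  moreover have "rsos_completion n r q \<alpha> x = fifo_completion a x 0 js"
    by (simp only: rsos_completion_def Let_def js_def a_def)
  ultimately show ?thesis by (simp add: aC)
qed

end

subsection \<open>The distribution of the \<open>\<alpha>\<close>-points\<close>

locale rsos_density =
  fixes \<delta> c :: real and f :: "real \<Rightarrow> real"
  assumes \<delta>: "1 \<le> \<delta>"
    and pdf: "pdf_on_unit f"
    and cond1: "x \<in> {0<..1} \<Longrightarrow> (LBINT \<alpha>:{0<..x}. \<delta> / (\<delta> + x - \<alpha>) * f \<alpha>) \<le> (c - 1) * x"
    and cond2: "x \<in> {0<..1} \<Longrightarrow>
           (1 + (LBINT \<alpha>:{0<..1}. \<delta> / (\<delta> + 1 - \<alpha>) * f \<alpha>)) * (LBINT \<alpha>:{1-x<..1}. f \<alpha>) \<le> c * x"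
begin

text \<open>The law of a single \<alpha>, spelled as in \<open>rsos_cost\<close> so that it folds
  there; the indicator discards the values of \<open>f\<close> outside the unit interval.\<close>

definition D :: "real measure" where
  "D = density lborel (\<lambda>y. ennreal (indicator {0<..1} y * f y))"

text \<open>The left-hand side of the first condition on \<open>f\<close>, in
  \<open>ennreal\<close>. Per unit of mean processing time it bounds the expected excess of a job of
  which the fraction \<open>x\<close> is virtually processed.\<close>

definition \<Phi> :: "real \<Rightarrow> ennreal" where
  "\<Phi> x = (\<integral>\<^sup>+b. (if b \<le> x then ennreal (\<delta> / (\<delta> + x - b)) else 0) \<partial>D)"

lemma f_nonneg: "x \<in> {0<..1} \<Longrightarrow> 0 \<le> f x"
  using pdf by (auto simp: pdf_on_unit_def)

lemma f_integrable: "integrable lborel (\<lambda>y. indicator {0<..1} y * f y)"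
  using pdf by (auto simp: pdf_on_unit_def set_integrable_def)

lemma f_measurable [measurable]: "(\<lambda>y. indicator {0<..1} y * f y) \<in> borel_measurable borel"
  using f_integrable by auto

lemma sets_D [measurable_cong, simp]: "sets D = sets borel"
  by (simp add: D_def)

lemma space_D [simp]: "space D = UNIV"
  by (simp add: D_def)

lemma AE_D: "AE b in D. b \<in> {0<..1}"
  unfolding D_def by (subst AE_density) (measurable, auto simp: indicator_def)

lemma nn_integral_D:
  assumes [measurable]: "g \<in> borel_measurable borel"
    and g: "\<And>b. b \<in> {0<..1} \<Longrightarrow> 0 \<le> g b \<and> g b \<le> 1"
  shows "(\<integral>\<^sup>+b. ennreal (g b) \<partial>D) = ennreal (LBINT b:{0<..1}. g b * f b)"
    and "0 \<le> (LBINT b:{0<..1}. g b * f b)"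
proof -
  have int: "integrable lborel (\<lambda>b. indicator {0<..1} b * f b * g b)"
  proof (rule Bochner_Integration.integrable_bound[OF f_integrable])
    show "AE b in lborel. norm (indicator {0<..1} b * f b * g b) \<le> norm (indicator {0<..1} b * f b)"
      using g f_nonneg by (auto simp: indicator_def abs_mult intro!: mult_left_le)
  qed measurable
  have nonneg: "0 \<le> indicator {0<..1} b * f b * g b" for b
    using g f_nonneg by (auto simp: indicator_def)
  have "(\<integral>\<^sup>+b. ennreal (g b) \<partial>D) = (\<integral>\<^sup>+b. ennreal (indicator {0<..1} b * f b) * ennreal (g b) \<partial>lborel)"
    unfolding D_def by (subst nn_integral_density) auto
  also have "\<dots> = (\<integral>\<^sup>+b. ennreal (indicator {0<..1} b * f b * g b) \<partial>lborel)"
    using f_nonneg by (intro nn_integral_cong) (auto simp: indicator_def ennreal_mult')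
  also have "\<dots> = ennreal (LBINT b. indicator {0<..1} b * f b * g b)"
    using nonneg by (intro nn_integral_eq_integral int) auto
  also have "(LBINT b. indicator {0<..1} b * f b * g b) = (LBINT b:{0<..1}. g b * f b)"
    by (simp add: set_lebesgue_integral_def mult_ac)
  finally show "(\<integral>\<^sup>+b. ennreal (g b) \<partial>D) = ennreal (LBINT b:{0<..1}. g b * f b)" .
  show "0 \<le> (LBINT b:{0<..1}. g b * f b)"
    unfolding set_lebesgue_integral_def using nonneg
    by (intro Bochner_Integration.integral_nonneg) (simp add: mult_ac)
qed

lemma prob_space_D: "prob_space D"
proof
  have "emeasure D (space D) = (\<integral>\<^sup>+b. ennreal 1 \<partial>D)" by simp
  also have "\<dots> = ennreal (LBINT b:{0<..1}. 1 * f b)" by (rule nn_integral_D) auto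
  also have "\<dots> = 1" using pdf by (simp add: pdf_on_unit_def)
  finally show "emeasure D (space D) = 1" .
qed

sublocale D: prob_space D by (rule prob_space_D)

lemma \<Phi>_eq:
  assumes "0 \<le> x" "x \<le> 1"
  shows "\<Phi> x = ennreal (LBINT \<alpha>:{0<..x}. \<delta> / (\<delta> + x - \<alpha>) * f \<alpha>)"
    and "0 \<le> (LBINT \<alpha>:{0<..x}. \<delta> / (\<delta> + x - \<alpha>) * f \<alpha>)"
proof -
  define g where "g = (\<lambda>b. if b \<le> x then \<delta> / (\<delta> + x - b) else 0)"
  have [measurable]: "g \<in> borel_measurable borel" unfolding g_def by measurable
  have g: "0 \<le> g b \<and> g b \<le> 1" for b using \<delta> by (auto simp: g_def divide_le_eq)
  have eq: "(LBINT b:{0<..1}. g b * f b) = (LBINT \<alpha>:{0<..x}. \<delta> / (\<delta> + x - \<alpha>) * f \<alpha>)"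
    unfolding set_lebesgue_integral_def
    using assms by (intro Bochner_Integration.integral_cong) (auto simp: g_def indicator_def)
  have "\<Phi> x = (\<integral>\<^sup>+b. ennreal (g b) \<partial>D)"
    unfolding \<Phi>_def g_def by (intro nn_integral_cong) auto
  then show "\<Phi> x = ennreal (LBINT \<alpha>:{0<..x}. \<delta> / (\<delta> + x - \<alpha>) * f \<alpha>)"
    using nn_integral_D(1)[of g] g eq by simp
  show "0 \<le> (LBINT \<alpha>:{0<..x}. \<delta> / (\<delta> + x - \<alpha>) * f \<alpha>)"
    using nn_integral_D(2)[of g] g eq by simp
qed

lemma c_ge_1: "1 \<le> c"
  using cond1[of 1] \<Phi>_eq(2)[of 1] by simp

lemma \<Phi>_le:
  assumes "0 \<le> x" "x \<le> 1"
  shows "\<Phi> x \<le> ennreal ((c - 1) * x)"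
\<comment> \<open>The first condition on \<open>f\<close> speaks of positive \<open>x\<close> only;
  at 0 the integral is over the empty interval.\<close>
proof (cases "x = 0")
  case True
  then show ?thesis using \<Phi>_eq(1)[of 0] by (simp add: set_lebesgue_integral_def)
next
  case False
  then show ?thesis using assms cond1[of x] \<Phi>_eq(1)[of x] by (simp add: ennreal_leI)
qed

lemma \<Phi>_measurable [measurable]: "\<Phi> \<in> borel_measurable borel"
  unfolding \<Phi>_def by measurable

text \<open>Serves for the charge of a job to itself. Pointwise \<open>a\<close> is at most the
  integrand of \<open>\<Phi> 1\<close>, so the first condition at 1 applies.\<close>

lemma expectation_le: "(\<integral>\<^sup>+a. ennreal a \<partial>D) \<le> ennreal (c - 1)"
proof -
  have "(\<integral>\<^sup>+a. ennreal a \<partial>D) \<le> \<Phi> 1"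
    unfolding \<Phi>_def
  proof (intro nn_integral_mono_AE)
    show "AE a in D. ennreal a \<le> (if a \<le> 1 then ennreal (\<delta> / (\<delta> + 1 - a)) else 0)"
      using AE_D
    proof eventually_elim
      case (elim a)
      \<comment> \<open>Clearing the denominator in
        \<open>a \<le> \<delta> / (\<delta> + 1 - a)\<close> leaves exactly this product.\<close>
      have "0 \<le> (\<delta> - a) * (1 - a)" using elim \<delta> by (intro mult_nonneg_nonneg) auto
      then have "a \<le> \<delta> / (\<delta> + 1 - a)" using elim \<delta> by (simp add: pos_le_divide_eq algebra_simps)
      then show ?case using elim by (auto intro: ennreal_leI)
    qed
  qed
  also have "\<dots> \<le> ennreal (c - 1)" using \<Phi>_le[of 1] by simp
  finally show ?thesis .
qed

text \<open>The second condition at \<open>x = 1 - m\<close>. \<open>D\<close> has no atoms, so the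
  closed endpoint \<open>m\<close> is harmless and the case \<open>m = 1\<close>, where the
  condition is silent, is trivial.\<close>

lemma upper_tail_le:
  assumes "0 \<le> m" "m \<le> 1"
  shows "(1 + \<Phi> 1) * emeasure D {m..1} \<le> ennreal (c * (1 - m))"
proof -
  have "emeasure D {m} = 0"
    unfolding D_def by (subst emeasure_density) (auto simp: nn_integral_null_set)
  then have "AE b in D. b \<noteq> m" by (intro AE_I[of _ _ "{m}"]) auto
  with AE_D have "AE b in D. b \<in> {m..1} \<longleftrightarrow> b \<in> {m<..}"
    by eventually_elim auto
  then have "emeasure D {m..1} = emeasure D {m<..}" by (intro emeasure_eq_AE) auto
  also have "\<dots> = (\<integral>\<^sup>+b. ennreal (indicator {m<..} b) \<partial>D)"
    by (simp add: ennreal_indicator)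
  also have "\<dots> = ennreal (LBINT b:{0<..1}. indicator {m<..} b * f b)"
    by (rule nn_integral_D) (auto simp: indicator_def)
  also have "(LBINT b:{0<..1}. indicator {m<..} b * f b) = (LBINT b:{m<..1}. f b)"
    unfolding set_lebesgue_integral_def
    using assms by (intro Bochner_Integration.integral_cong) (auto simp: indicator_def)
  finally have e: "emeasure D {m..1} = ennreal (LBINT b:{m<..1}. f b)" .
  show ?thesis
  proof (cases "m = 1")
    case True
    then show ?thesis using \<open>emeasure D {m} = 0\<close> by simp
  next
    case False
    let ?L = "LBINT \<alpha>:{0<..1}. \<delta> / (\<delta> + 1 - \<alpha>) * f \<alpha>"
    have "(1 + \<Phi> 1) * emeasure D {m..1} = ennreal ((1 + ?L) * (LBINT b:{m<..1}. f b))"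
      using \<Phi>_eq[of 1] by (simp add: e ennreal_mult' flip: ennreal_plus ennreal_1)
    also have "\<dots> \<le> ennreal (c * (1 - m))"
      using cond2[of "1 - m"] False assms by (intro ennreal_leI) auto
    finally show ?thesis .
  qed
qed

text \<open>A constant progress \<open>x\<close> is charged \<open>x + \<Phi> x \<le> c * x\<close>
  by the first condition; on the right stands the same progress averaged over a uniform
  \<alpha>.\<close>

lemma nn_integral_const_charge:
  assumes "\<And>a. a \<in> {0<..1} \<Longrightarrow> h a = x" "0 \<le> x" "x \<le> 1"
  shows "(\<integral>\<^sup>+a. ennreal (h a) + \<Phi> (h a) \<partial>D)
    \<le> ennreal c * (\<integral>\<^sup>+a. ennreal (h a) * indicator {0<..1} a \<partial>lborel)"
proof -
  have "(\<integral>\<^sup>+a. ennreal (h a) + \<Phi> (h a) \<partial>D) = (\<integral>\<^sup>+a. ennreal x + \<Phi> x \<partial>D)"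
    by (intro nn_integral_cong_AE eventually_mono[OF AE_D]) (simp add: assms(1))
  also have "\<dots> = ennreal x + \<Phi> x" by (simp add: D.emeasure_space_1[simplified])
  also have "\<dots> \<le> ennreal x + ennreal ((c - 1) * x)"
    using \<Phi>_le assms by (intro add_left_mono) auto
  also have "\<dots> = ennreal c * ennreal x"
    using assms(2) c_ge_1 by (subst ennreal_plus[symmetric]) (auto simp: ennreal_mult[symmetric] algebra_simps mult_le_cancel_right1)
  also have "ennreal x = (\<integral>\<^sup>+a. ennreal (h a) * indicator {0<..1} a \<partial>lborel)"
  proof -
    have "(\<integral>\<^sup>+a. ennreal (h a) * indicator {0<..1} a \<partial>lborel)
        = (\<integral>\<^sup>+a. ennreal x * indicator {0<..1::real} a \<partial>lborel)"
      using assms(1) by (intro nn_integral_cong) (auto simp: indicator_def)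
    then show ?thesis by (simp add: nn_integral_cmult)
  qed
  finally show ?thesis .
qed

text \<open>A monotone 0-1 progress is the indicator of an upper part of the unit interval. The
  charge is then \<open>1 + \<Phi> 1\<close> times a tail of \<open>D\<close>, which the second
  condition compares with the tail of the uniform distribution.\<close>

lemma nn_integral_step_charge:
  assumes "\<And>a. a \<in> {0<..1} \<Longrightarrow> h a = 0 \<or> h a = 1"
    and mono: "\<And>a b. 0 < a \<Longrightarrow> a \<le> b \<Longrightarrow> b \<le> 1 \<Longrightarrow> h a \<le> (h b :: real)"
  shows "(\<integral>\<^sup>+a. ennreal (h a) + \<Phi> (h a) \<partial>D)
    \<le> ennreal c * (\<integral>\<^sup>+a. ennreal (h a) * indicator {0<..1} a \<partial>lborel)"
proof (cases "\<exists>a\<in>{0<..1}. h a = 1")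
  case False
  then show ?thesis using assms(1) by (intro nn_integral_const_charge[of h 0]) auto
next
  case True
  define U where "U = {a\<in>{0<..1}. h a = 1}"
  \<comment> \<open>The jump of \<open>h\<close>. Its value at \<open>m\<close> is left open: the
    upper estimate uses \<open>{m..1}\<close>, the lower one \<open>{m<..1}\<close>.\<close>
  define m where "m = Inf U"
  have ne: "U \<noteq> {}" using True by (auto simp: U_def)
  have bdd: "bdd_below U" by (auto simp: U_def intro!: bdd_belowI[of _ 0])
  have m: "0 \<le> m" "m \<le> 1"
    using ne bdd unfolding m_def by (auto simp: U_def intro!: cInf_greatest intro: cInf_lower2)
  have mU: "m \<le> a" if "a \<in> U" for a using that bdd by (auto simp: m_def intro: cInf_lower)
  have Um: "h a = 1" if a: "m < a" "a \<le> 1" for a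
  proof -
    obtain b where "b \<in> U" "b < a" using a(1) cInf_less_iff[OF ne bdd, of a] by (auto simp: m_def)
    then show ?thesis using mono[of b a] a assms(1)[of a] by (auto simp: U_def)
  qed
  have "\<Phi> 0 = 0" using \<Phi>_le[of 0] by simp
  have "(\<integral>\<^sup>+a. ennreal (h a) + \<Phi> (h a) \<partial>D) \<le> (\<integral>\<^sup>+a. (1 + \<Phi> 1) * indicator {m..1} a \<partial>D)"
  proof (intro nn_integral_mono_AE)
    show "AE a in D. ennreal (h a) + \<Phi> (h a) \<le> (1 + \<Phi> 1) * indicator {m..1} a"
      using AE_D
    proof eventually_elim
      case (elim a)
      show ?case
      proof (cases "h a = 1")
        case True
        then show ?thesis using elim mU[of a] by (simp add: U_def)
      next
        case False
        then show ?thesis using elim assms(1)[of a] \<open>\<Phi> 0 = 0\<close> by auto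
      qed
    qed
  qed
  also have "\<dots> = (1 + \<Phi> 1) * emeasure D {m..1}" by (simp add: nn_integral_cmult)
  also have "\<dots> \<le> ennreal (c * (1 - m))" by (rule upper_tail_le) fact+
  also have "\<dots> = ennreal c * (\<integral>\<^sup>+a. indicator {m<..1} a \<partial>lborel)"
    using m c_ge_1 by (simp add: ennreal_mult)
  also have "\<dots> \<le> ennreal c * (\<integral>\<^sup>+a. ennreal (h a) * indicator {0<..1} a \<partial>lborel)"
    using m Um by (intro mult_left_mono nn_integral_mono) (auto simp: indicator_def)
  finally show ?thesis .
qed

end

section \<open>Expected charges to a single job\<close>

locale rsos_analysis = preemptive_schedule n r q + rsos_density \<delta> c f
  for n r q \<delta> c f
begin

text \<open>Clamping the argument to the unit interval makes the \<open>\<alpha>\<close>-point a monotone, hence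
  measurable, function on the whole real line.\<close>

definition cpoint :: "nat \<Rightarrow> real \<Rightarrow> real" where
  "cpoint j a = apoint j (max 0 (min 1 a))"

lemma cpoint_eq: "a \<in> {0<..1} \<Longrightarrow> cpoint j a = apoint j a"
  by (simp add: cpoint_def)

lemma cpoint_measurable: "j \<in> {1..n} \<Longrightarrow> cpoint j \<in> borel_measurable borel"
  unfolding cpoint_def by (intro borel_measurable_mono monoI apoint_mono) auto

text \<open>The fraction \<open>\<eta>\<^sub>k\<close>, as a function of the clamped \<alpha> of job
  \<open>j\<close>.\<close>

definition progress :: "nat \<Rightarrow> nat \<Rightarrow> real \<Rightarrow> real" where
  "progress j k a = work k (cpoint j a) / q k"

lemma progress_measurable: "j \<in> {1..n} \<Longrightarrow> progress j k \<in> borel_measurable borel"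
  unfolding progress_def using cpoint_measurable[of j] by measurable

lemma progress_bounds: "k \<in> {1..n} \<Longrightarrow> 0 \<le> progress j k a \<and> progress j k a \<le> 1"
  using q_pos[of k] work_le[of k] sp_work_nonneg[of r q k] by (auto simp: progress_def)

lemma progress_self: "j \<in> {1..n} \<Longrightarrow> a \<in> {0<..1} \<Longrightarrow> progress j j a = a"
  using q_pos[of j] by (simp add: progress_def cpoint_eq work_apoint)

lemma cpoint_decomp:
  assumes j: "j \<in> {1..n}" and a: "a \<in> {0<..1}"
  shows "ennreal (cpoint j a) = ennreal (idle_before j) + ennreal (q j) * ennreal a
           + (\<Sum>k\<in>{1..n} - {j}. ennreal (q k) * ennreal (progress j k a))"
proof -
  have "cpoint j a = idle_before j + (\<Sum>k\<in>{1..n}. q k * progress j k a)"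
  proof -
    have "q k * progress j k a = work k (cpoint j a)" if "k \<in> {1..n}" for k
      using q_pos[OF that] by (simp add: progress_def)
    then show ?thesis using apoint_decomp[OF j, of a] a by (simp add: cpoint_eq)
  qed
  also have "(\<Sum>k\<in>{1..n}. q k * progress j k a) = q j * a + (\<Sum>k\<in>{1..n} - {j}. q k * progress j k a)"
    using j a by (subst sum.remove[of _ j]) (auto simp: progress_self)
  finally have "ennreal (cpoint j a) = ennreal (idle_before j + (q j * a + (\<Sum>k\<in>{1..n} - {j}. q k * progress j k a)))"
    by simp
  also have "\<dots> = ennreal (idle_before j) + (ennreal (q j * a) + ennreal (\<Sum>k\<in>{1..n} - {j}. q k * progress j k a))"
    using idle_before_nonneg[OF j] q_pos[OF j] a q_pos[THEN less_imp_le] progress_bounds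
    by (subst ennreal_plus, simp, force intro!: add_nonneg_nonneg sum_nonneg)
       (subst ennreal_plus, auto intro!: sum_nonneg)
  also have "ennreal (\<Sum>k\<in>{1..n} - {j}. q k * progress j k a) = (\<Sum>k\<in>{1..n} - {j}. ennreal (q k * progress j k a))"
    using q_pos[THEN less_imp_le] progress_bounds by (intro sum_ennreal[symmetric]) auto
  also have "\<dots> = (\<Sum>k\<in>{1..n} - {j}. ennreal (q k) * ennreal (progress j k a))"
    using q_pos[THEN less_imp_le] progress_bounds by (intro sum.cong ennreal_mult) auto
  finally show ?thesis
    using q_pos[OF j] a by (simp add: ennreal_mult add.assoc)
qed

text \<open>Jobs of larger index than \<open>j\<close> have the same progress at all \<alpha>-points
  of \<open>j\<close> and fall under the first condition; those of smaller index are untouched or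
  finished there, a 0-1 step handled by the second.\<close>

lemma progress_charge:
  assumes j: "j \<in> {1..n}" and k: "k \<in> {1..n} - {j}"
  shows "(\<integral>\<^sup>+a. ennreal (progress j k a) + \<Phi> (progress j k a) \<partial>D)
    \<le> ennreal c * (\<integral>\<^sup>+a. ennreal (progress j k a) * indicator {0<..1} a \<partial>lborel)"
proof (cases "j < k")
  case True
  have "progress j k a = work k (apoint j 1) / q k" if "a \<in> {0<..1}" for a
    using that work_apoint_lower_priority[OF j True, of a] by (simp add: progress_def cpoint_eq)
  then show ?thesis
    using progress_bounds[of k j 1] k by (intro nn_integral_const_charge[of _ "progress j k 1"]) (auto simp: progress_def cpoint_eq)
next
  case False
  show ?thesis
  proof (rule nn_integral_step_charge)
    show "progress j k a = 0 \<or> progress j k a = 1" if "a \<in> {0<..1}" for a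
      using that work_apoint_higher_priority[OF j, of k a] False k q_pos[of k]
      by (auto simp: progress_def cpoint_eq)
    show "progress j k a \<le> progress j k b" if "0 < a" "a \<le> b" "b \<le> 1" for a b
    proof -
      have "work k (apoint j a) \<le> work k (apoint j b)"
        using that apoint_mono[OF j, of a b] apoint_nonneg[OF j, of a] by (intro sp_work_mono) auto
      then show ?thesis using that q_pos[of k] k by (simp add: progress_def cpoint_eq divide_right_mono)
    qed
  qed
qed

text \<open>By \<open>cpoint_decomp\<close> the left side splits into the idle time, the share of
  \<open>j\<close> and one charge per other job. Each is compared with \<open>c\<close> times its
  counterpart for a uniform \<alpha>, and the counterparts recombine to the mean busy time plus
  \<open>q j / 2\<close>.\<close>

lemma charge_le_mean_busy_time:
  assumes j: "j \<in> {1..n}"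
  shows "(\<integral>\<^sup>+a. ennreal (cpoint j a) \<partial>D) + ennreal (q j)
      + (\<Sum>k\<in>{1..n} - {j}. ennreal (q k) * (\<integral>\<^sup>+a. \<Phi> (progress j k a) \<partial>D))
    \<le> ennreal (c * (sp_mean_busy_time r q j + q j / 2))"
proof -
  note [measurable] = progress_measurable[OF j] cpoint_measurable[OF j]
  let ?K = "{1..n} - {j}"
  define F where "F = (\<lambda>k. \<integral>\<^sup>+a. ennreal (progress j k a) * indicator {0<..1} a \<partial>lborel)"
  have unit: "(\<integral>\<^sup>+a. ennreal a * indicator {0<..1} a \<partial>lborel) = ennreal (1/2)"
  proof -
    have "(\<integral>\<^sup>+a. ennreal a * indicator {0<..1} a \<partial>lborel) = (\<integral>\<^sup>+a. ennreal a * indicator {0..0 + 1} a \<partial>lborel)"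
      by (intro nn_integral_cong) (auto simp: indicator_def)
    then show ?thesis using nn_integral_Icc_id[of 0 1] by simp
  qed
  have "(\<integral>\<^sup>+a. ennreal (cpoint j a) \<partial>D)
      = (\<integral>\<^sup>+a. ennreal (idle_before j) + ennreal (q j) * ennreal a
           + (\<Sum>k\<in>?K. ennreal (q k) * ennreal (progress j k a)) \<partial>D)"
    by (intro nn_integral_cong_AE eventually_mono[OF AE_D]) (simp only: cpoint_decomp[OF j])
  also have "\<dots> = ennreal (idle_before j) + ennreal (q j) * (\<integral>\<^sup>+a. ennreal a \<partial>D)
      + (\<Sum>k\<in>?K. ennreal (q k) * (\<integral>\<^sup>+a. ennreal (progress j k a) \<partial>D))"
    by (simp add: nn_integral_add nn_integral_sum nn_integral_cmult D.emeasure_space_1[simplified])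
  finally have "(\<integral>\<^sup>+a. ennreal (cpoint j a) \<partial>D) + ennreal (q j)
      + (\<Sum>k\<in>?K. ennreal (q k) * (\<integral>\<^sup>+a. \<Phi> (progress j k a) \<partial>D))
      = ennreal (idle_before j) + ennreal (q j) * (1 + (\<integral>\<^sup>+a. ennreal a \<partial>D))
      + (\<Sum>k\<in>?K. ennreal (q k) * (\<integral>\<^sup>+a. ennreal (progress j k a) + \<Phi> (progress j k a) \<partial>D))"
    by (simp add: nn_integral_add distrib_left sum.distrib add_ac)
  also have "\<dots> \<le> ennreal c * ennreal (idle_before j) + ennreal (q j) * ennreal c
      + (\<Sum>k\<in>?K. ennreal (q k) * (ennreal c * F k))"
  proof (intro add_mono sum_mono mult_left_mono)
    show "ennreal (idle_before j) \<le> ennreal c * ennreal (idle_before j)"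
      using mult_right_mono[of 1 "ennreal c" "ennreal (idle_before j)"] c_ge_1 by simp
    have "1 + (\<integral>\<^sup>+a. ennreal a \<partial>D) \<le> 1 + ennreal (c - 1)"
      by (intro add_left_mono expectation_le)
    also have "\<dots> = ennreal c" using c_ge_1 by (simp flip: ennreal_plus ennreal_1)
    finally show "1 + (\<integral>\<^sup>+a. ennreal a \<partial>D) \<le> ennreal c" .
    show "(\<integral>\<^sup>+a. ennreal (progress j k a) + \<Phi> (progress j k a) \<partial>D) \<le> ennreal c * F k" if "k \<in> ?K" for k
      unfolding F_def using j that by (rule progress_charge)
  qed auto
  \<comment> \<open>The charge \<open>c * q j\<close> is halved: one half is the share of
    \<open>j\<close> in its own average \<alpha>-point, the other gives the summand
    \<open>q j / 2\<close>.\<close>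
  also have "\<dots> = ennreal c * ((ennreal (idle_before j) + ennreal (q j) * ennreal (1/2)
      + (\<Sum>k\<in>?K. ennreal (q k) * F k)) + ennreal (q j) * ennreal (1/2))"
  proof -
    have half: "ennreal (q j) = ennreal (q j) * ennreal (1/2) + ennreal (q j) * ennreal (1/2)"
      using q_pos[OF j] by (subst (1 2) ennreal_mult[symmetric]) (auto simp flip: ennreal_plus)
    have "ennreal (q j) * ennreal c
        = ennreal c * (ennreal (q j) * ennreal (1/2)) + ennreal c * (ennreal (q j) * ennreal (1/2))"
      by (subst half) (simp add: distrib_left distrib_right mult_ac)
    then show ?thesis by (simp add: distrib_left sum_distrib_left mult_ac add_ac)
  qed
  also have "ennreal (idle_before j) + ennreal (q j) * ennreal (1/2) + (\<Sum>k\<in>?K. ennreal (q k) * F k)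
      = (\<integral>\<^sup>+a. (ennreal (idle_before j) + ennreal (q j) * ennreal a
           + (\<Sum>k\<in>?K. ennreal (q k) * ennreal (progress j k a))) * indicator {0<..1} a \<partial>lborel)"
    unfolding F_def unit[symmetric]
    by (simp add: nn_integral_add nn_integral_sum nn_integral_cmult distrib_right sum_distrib_right mult.assoc)
  also have "\<dots> = (\<integral>\<^sup>+a. ennreal (apoint j a) * indicator {0<..1} a \<partial>lborel)"
  proof (intro nn_integral_cong)
    fix a :: real
    show "(ennreal (idle_before j) + ennreal (q j) * ennreal a
        + (\<Sum>k\<in>?K. ennreal (q k) * ennreal (progress j k a))) * indicator {0<..1} a
        = ennreal (apoint j a) * indicator {0<..1} a"
      using cpoint_decomp[OF j, of a] cpoint_eq[of a j] by (cases "a \<in> {0<..1}") auto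
  qed
  also have "\<dots> = ennreal (sp_mean_busy_time r q j)"
    by (rule nn_integral_apoint_eq_mean_busy_time[OF j])
  also have "ennreal c * (ennreal (sp_mean_busy_time r q j) + ennreal (q j) * ennreal (1/2))
      = ennreal (c * (sp_mean_busy_time r q j + q j / 2))"
    using c_ge_1 q_pos[OF j] nn_integral_busy_eq_mean_busy_time(2)[OF j]
    by (subst ennreal_mult[of "q j" "1/2", symmetric]) (auto simp: ennreal_mult)
  finally show ?thesis .
qed

end

subsection \<open>Expected cost of RSOS\<close>

lemma AE_pair_fst:
  assumes "sigma_finite_measure N2" "AE x in N1. P x"
  shows "AE z in N1 \<Otimes>\<^sub>M N2. P (fst z)"
proof -
  interpret sigma_finite_measure N2 by fact
  obtain N where N: "{x \<in> space N1. \<not> P x} \<subseteq> N" "emeasure N1 N = 0" "N \<in> sets N1"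
    using assms(2) by (rule AE_E)
  then have "emeasure (N1 \<Otimes>\<^sub>M N2) (N \<times> space N2) = 0"
    by (subst emeasure_pair_measure_Times) auto
  then show ?thesis
    using N by (intro AE_I[of _ _ "N \<times> space N2"]) (auto simp: space_pair_measure)
qed

lemma AE_pair_snd:
  assumes "sigma_finite_measure N2" "AE y in N2. P y"
  shows "AE z in N1 \<Otimes>\<^sub>M N2. P (snd z)"
proof -
  interpret sigma_finite_measure N2 by fact
  obtain N where N: "{x \<in> space N2. \<not> P x} \<subseteq> N" "emeasure N2 N = 0" "N \<in> sets N2"
    using assms(2) by (rule AE_E)
  then have "emeasure (N1 \<Otimes>\<^sub>M N2) (space N1 \<times> N) = 0"
    by (subst emeasure_pair_measure_Times) auto
  then show ?thesis
    using N by (intro AE_I[of _ _ "space N1 \<times> N"]) (auto simp: space_pair_measure)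
qed

context rsos_analysis
begin

text \<open>\<open>ennreal\<close> sends negative reals to 0, so the integrand is a positive part.
  The threshold is measured in units of the mean, which cancels in the NBUE bound.\<close>

lemma nn_integral_excess_le:
  assumes "prob_space M" "integrable M X" "AE \<omega> in M. 0 \<le> X \<omega>" "delta_NBUE M \<delta> X"
    and q: "q k = (LINT \<omega>|M. X \<omega>)" and k: "k \<in> {1..n}" and y: "0 \<le> y"
  shows "(\<integral>\<^sup>+\<omega>. ennreal (X \<omega> - y * q k) \<partial>M) \<le> ennreal (q k) * ennreal (\<delta> / (\<delta> + y))"
proof -
  have int: "integrable M (\<lambda>\<omega>. max 0 (X \<omega> - y * q k))"
    using assms(1,2) prob_space.finite_measure[OF assms(1)] by (auto intro!: integrable_max finite_measure.integrable_const)
  have "(\<integral>\<^sup>+\<omega>. ennreal (X \<omega> - y * q k) \<partial>M) = (\<integral>\<^sup>+\<omega>. ennreal (max 0 (X \<omega> - y * q k)) \<partial>M)"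
    by (intro nn_integral_cong) (auto simp: max_def ennreal_neg)
  also have "\<dots> = ennreal (LINT \<omega>|M. max 0 (X \<omega> - y * q k))"
    by (intro nn_integral_eq_integral int) auto
  also have "\<dots> \<le> ennreal (q k * (\<delta> / (\<delta> + y * q k / q k)))"
    using assms \<delta> q_pos[OF k] by (intro ennreal_leI delta_NBUE_excess) auto
  also have "\<dots> = ennreal (q k) * ennreal (\<delta> / (\<delta> + y))"
    using q_pos[OF k] \<delta> y by (subst ennreal_mult[symmetric]) auto
  finally show ?thesis .
qed

text \<open>Each term of the pathwise bound involves at most one processing time and at most two of
  the \<alpha>, so linearity and Fubini reduce the cost to
  \<open>charge_le_mean_busy_time\<close>.\<close>

lemma rsos_cost_le:
  fixes M :: "'a measure" and p :: "nat \<Rightarrow> 'a \<Rightarrow> real" and w :: "nat \<Rightarrow> real"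
  assumes "prob_space M"
    and w: "\<And>j. j \<in> {1..n} \<Longrightarrow> 0 \<le> w j"
    and p_nonneg: "\<And>j. j \<in> {1..n} \<Longrightarrow> AE \<omega> in M. 0 \<le> p j \<omega>"
    and p_int: "\<And>j. j \<in> {1..n} \<Longrightarrow> integrable M (p j)"
    and q: "\<And>j. q j = (LINT \<omega>|M. p j \<omega>)"
    and NBUE: "\<And>j. j \<in> {1..n} \<Longrightarrow> delta_NBUE M \<delta> (p j)"
  shows "rsos_cost n w r M p f
    \<le> ennreal (c * (\<Sum>j=1..n. w j * (sp_mean_busy_time r q j + q j / 2)))"
proof -
  interpret M: prob_space M by fact
  define P where "P = PiM {1..n} (\<lambda>_. D)"
  interpret P: prob_space P unfolding P_def by (intro prob_space_PiM prob_space_D)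
  interpret MP: pair_prob_space M P ..
  have p_meas: "p j \<in> borel_measurable M" if "j \<in> {1..n}" for j
    using p_int[OF that] by auto
  have comp: "(\<lambda>\<alpha>. \<alpha> k) \<in> borel_measurable P" if "k \<in> {1..n}" for k
    unfolding P_def using that measurable_component_singleton[of k "{1..n}" "\<lambda>_. D"]
    by (simp cong: measurable_cong_sets)
  \<comment> \<open>The delay that \<open>k\<close> may cause to \<open>j\<close>; the cast to
    \<open>ennreal\<close> takes the positive part.\<close>
  define E where "E = (\<lambda>j k \<omega> \<alpha>. if \<alpha> k \<le> progress j k (\<alpha> j)
    then ennreal (p k \<omega> - (progress j k (\<alpha> j) - \<alpha> k) * q k) else 0)"
  define B where "B = (\<lambda>j \<omega> \<alpha>. ennreal (cpoint j (\<alpha> j)) + ennreal (p j \<omega>) + (\<Sum>k\<in>{1..n} - {j}. E j k \<omega> \<alpha>))"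
  have E_meas: "(\<lambda>z. E j k (fst z) (snd z)) \<in> borel_measurable (M \<Otimes>\<^sub>M P)"
    if "j \<in> {1..n}" "k \<in> {1..n}" for j k
    unfolding E_def using comp[OF that(1)] comp[OF that(2)] p_meas[OF that(2)] progress_measurable[OF that(1)]
    by measurable
  have c_meas: "(\<lambda>\<alpha>. cpoint j (\<alpha> j)) \<in> borel_measurable P" if "j \<in> {1..n}" for j
    using cpoint_measurable[OF that] comp[OF that] by measurable
  have B_meas: "(\<lambda>z. B j (fst z) (snd z)) \<in> borel_measurable (M \<Otimes>\<^sub>M P)" if "j \<in> {1..n}" for j
    unfolding B_def using E_meas that c_meas[OF that] p_meas[OF that] by measurable

  have B_int: "(\<integral>\<^sup>+z. B j (fst z) (snd z) \<partial>(M \<Otimes>\<^sub>M P)) \<le> ennreal (c * (sp_mean_busy_time r q j + q j / 2))"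
    if j: "j \<in> {1..n}" for j
  proof -
    have term1: "(\<integral>\<^sup>+z. ennreal (cpoint j (snd z j)) \<partial>(M \<Otimes>\<^sub>M P)) = (\<integral>\<^sup>+a. ennreal (cpoint j a) \<partial>D)"
    proof -
      have "(\<integral>\<^sup>+z. ennreal (cpoint j (snd z j)) \<partial>(M \<Otimes>\<^sub>M P)) = (\<integral>\<^sup>+\<alpha>. ennreal (cpoint j (\<alpha> j)) \<partial>P)"
        using c_meas[OF j] by (subst MP.nn_integral_snd[symmetric]) (auto simp: M.emeasure_space_1)
      also have "\<dots> = (\<integral>\<^sup>+a. ennreal (cpoint j a) \<partial>D)"
        unfolding P_def using j cpoint_measurable[OF j]
        by (intro nn_integral_PiM_component[where g="\<lambda>a. ennreal (cpoint j a)"] prob_space_D)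
           (auto cong: measurable_cong_sets)
      finally show ?thesis .
    qed
    have term2: "(\<integral>\<^sup>+z. ennreal (p j (fst z)) \<partial>(M \<Otimes>\<^sub>M P)) = ennreal (q j)"
    proof -
      have "(\<integral>\<^sup>+z. ennreal (p j (fst z)) \<partial>(M \<Otimes>\<^sub>M P)) = (\<integral>\<^sup>+\<omega>. ennreal (p j \<omega>) \<partial>M)"
        using p_meas[OF j] by (subst P.nn_integral_fst[symmetric]) (auto simp: P.emeasure_space_1)
      also have "\<dots> = ennreal (q j)"
        using p_int[OF j] p_nonneg[OF j] by (simp add: q nn_integral_eq_integral)
      finally show ?thesis .
    qed
    \<comment> \<open>For fixed \<alpha> the processing time is averaged first, by the NBUE
      property. Averaging over \<open>\<alpha> k\<close> then gives \<open>\<Phi>\<close> at the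
      progress, which depends on \<open>\<alpha> j\<close> alone.\<close>
    have term3: "(\<integral>\<^sup>+z. E j k (fst z) (snd z) \<partial>(M \<Otimes>\<^sub>M P)) \<le> ennreal (q k) * (\<integral>\<^sup>+a. \<Phi> (progress j k a) \<partial>D)"
      if k: "k \<in> {1..n} - {j}" for k
    proof -
      note [measurable] = progress_measurable[OF j, of k]
      have "(\<integral>\<^sup>+z. E j k (fst z) (snd z) \<partial>(M \<Otimes>\<^sub>M P)) = (\<integral>\<^sup>+\<alpha>. \<integral>\<^sup>+\<omega>. E j k \<omega> \<alpha> \<partial>M \<partial>P)"
        using E_meas[OF j, of k] k by (subst MP.nn_integral_snd[symmetric]) auto
      also have "\<dots> \<le> (\<integral>\<^sup>+\<alpha>. ennreal (q k) * (if \<alpha> k \<le> progress j k (\<alpha> j)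
          then ennreal (\<delta> / (\<delta> + progress j k (\<alpha> j) - \<alpha> k)) else 0) \<partial>P)"
      proof (intro nn_integral_mono)
        fix \<alpha>
        show "(\<integral>\<^sup>+\<omega>. E j k \<omega> \<alpha> \<partial>M) \<le> ennreal (q k) * (if \<alpha> k \<le> progress j k (\<alpha> j)
          then ennreal (\<delta> / (\<delta> + progress j k (\<alpha> j) - \<alpha> k)) else 0)"
          using nn_integral_excess_le[OF \<open>prob_space M\<close> p_int[of k] p_nonneg[of k] NBUE[of k] q[of k], of "progress j k (\<alpha> j) - \<alpha> k"] k
          by (auto simp: E_def add_diff_eq)
      qed
      also have "\<dots> = (\<integral>\<^sup>+a. \<integral>\<^sup>+b. ennreal (q k) * (if b \<le> progress j k a
          then ennreal (\<delta> / (\<delta> + progress j k a - b)) else 0) \<partial>D \<partial>D)"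
        unfolding P_def
      proof (rule nn_integral_PiM_two_components[where g="\<lambda>a b. ennreal (q k) * (if b \<le> progress j k a
          then ennreal (\<delta> / (\<delta> + progress j k a - b)) else 0)", OF prob_space_D])
        show "(\<lambda>(a, b). ennreal (q k) * (if b \<le> progress j k a
          then ennreal (\<delta> / (\<delta> + progress j k a - b)) else 0)) \<in> borel_measurable (D \<Otimes>\<^sub>M D)"
          by measurable
      qed (use j k in auto)
      also have "\<dots> = (\<integral>\<^sup>+a. ennreal (q k) * \<Phi> (progress j k a) \<partial>D)"
        unfolding \<Phi>_def by (intro nn_integral_cong nn_integral_cmult) measurable
      also have "\<dots> = ennreal (q k) * (\<integral>\<^sup>+a. \<Phi> (progress j k a) \<partial>D)"
        by (intro nn_integral_cmult) measurable
      finally show ?thesis .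
    qed
    have "(\<integral>\<^sup>+z. B j (fst z) (snd z) \<partial>(M \<Otimes>\<^sub>M P))
        = (\<integral>\<^sup>+z. ennreal (cpoint j (snd z j)) \<partial>(M \<Otimes>\<^sub>M P)) + (\<integral>\<^sup>+z. ennreal (p j (fst z)) \<partial>(M \<Otimes>\<^sub>M P))
          + (\<Sum>k\<in>{1..n} - {j}. \<integral>\<^sup>+z. E j k (fst z) (snd z) \<partial>(M \<Otimes>\<^sub>M P))"
    proof -
      have m12 [measurable]: "(\<lambda>z. ennreal (cpoint j (snd z j))) \<in> borel_measurable (M \<Otimes>\<^sub>M P)"
        "(\<lambda>z. ennreal (p j (fst z))) \<in> borel_measurable (M \<Otimes>\<^sub>M P)"
        using c_meas[OF j] p_meas[OF j] by measurable
      have E': "k \<in> {1..n} - {j} \<Longrightarrow> (\<lambda>z. E j k (fst z) (snd z)) \<in> borel_measurable (M \<Otimes>\<^sub>M P)" for k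
        using E_meas[OF j] by auto
      have "(\<integral>\<^sup>+z. B j (fst z) (snd z) \<partial>(M \<Otimes>\<^sub>M P))
          = (\<integral>\<^sup>+z. ennreal (cpoint j (snd z j)) + ennreal (p j (fst z)) \<partial>(M \<Otimes>\<^sub>M P))
            + (\<integral>\<^sup>+z. (\<Sum>k\<in>{1..n} - {j}. E j k (fst z) (snd z)) \<partial>(M \<Otimes>\<^sub>M P))"
        unfolding B_def by (intro nn_integral_add borel_measurable_sum E') measurable
      then show ?thesis by (simp only: nn_integral_sum[OF E'] nn_integral_add[OF m12])
    qed
    also have "\<dots> \<le> (\<integral>\<^sup>+a. ennreal (cpoint j a) \<partial>D) + ennreal (q j)
        + (\<Sum>k\<in>{1..n} - {j}. ennreal (q k) * (\<integral>\<^sup>+a. \<Phi> (progress j k a) \<partial>D))"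
      unfolding term1 term2 by (intro add_left_mono sum_mono term3)
    also have "\<dots> \<le> ennreal (c * (sp_mean_busy_time r q j + q j / 2))"
      by (rule charge_le_mean_busy_time[OF j])
    finally show ?thesis .
  qed

  have AE1: "AE z in M \<Otimes>\<^sub>M P. \<forall>k\<in>{1..n}. 0 \<le> p k (fst z)"
    using p_nonneg by (intro AE_pair_fst P.sigma_finite_measure) (auto intro!: AE_finite_allI)
  have AE2: "AE z in M \<Otimes>\<^sub>M P. \<forall>k\<in>{1..n}. snd z k \<in> {0<..1}"
  proof (intro AE_pair_snd P.sigma_finite_measure AE_finite_allI)
    fix k assume "k \<in> {1..n}"
    then show "AE \<alpha> in P. \<alpha> k \<in> {0<..1}"
      unfolding P_def using AE_D by (intro AE_PiM_component prob_space_D) auto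
  qed simp
  have "rsos_cost n w r M p f = (\<integral>\<^sup>+z. ennreal (\<Sum>j=1..n. w j *
          rsos_completion n r q (snd z) (\<lambda>k. p k (fst z)) j) \<partial>(M \<Otimes>\<^sub>M P))"
    unfolding rsos_cost_def D_def[symmetric] P_def[symmetric] q[symmetric] case_prod_beta' ..
  also have "\<dots> \<le> (\<integral>\<^sup>+z. (\<Sum>j=1..n. ennreal (w j) * B j (fst z) (snd z)) \<partial>(M \<Otimes>\<^sub>M P))"
  proof (intro nn_integral_mono_AE)
    show "AE z in M \<Otimes>\<^sub>M P. ennreal (\<Sum>j=1..n. w j * rsos_completion n r q (snd z) (\<lambda>k. p k (fst z)) j)
        \<le> (\<Sum>j=1..n. ennreal (w j) * B j (fst z) (snd z))"
      using AE1 AE2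
    proof eventually_elim
      case (elim z)
      define \<omega> \<alpha> where "\<omega> = fst z" "\<alpha> = snd z"
      have \<alpha>: "\<alpha> k \<in> {0<..1}" and x: "0 \<le> p k \<omega>" if "k \<in> {1..n}" for k
        using elim that by (auto simp: \<omega>_\<alpha>_def)
      \<comment> \<open>The real-valued counterpart of \<open>E\<close> as
        \<open>rsos_completion_le\<close> produces it, with work in place of fractions.\<close>
      define R where "R = (\<lambda>j k. if \<alpha> k * q k \<le> work k (apoint j (\<alpha> j))
        then max 0 (p k \<omega> - (work k (apoint j (\<alpha> j)) - \<alpha> k * q k)) else 0)"
      have R: "ennreal (R j k) = E j k \<omega> \<alpha>" if "j \<in> {1..n}" "k \<in> {1..n}" for j k
      proof -
        have qk: "0 < q k" using q_pos that by simp
        have "\<alpha> k \<le> progress j k (\<alpha> j) \<longleftrightarrow> \<alpha> k * q k \<le> work k (apoint j (\<alpha> j))"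
          using qk \<alpha>[OF that(1)] by (simp add: progress_def cpoint_eq pos_le_divide_eq)
        moreover have "(progress j k (\<alpha> j) - \<alpha> k) * q k = work k (apoint j (\<alpha> j)) - \<alpha> k * q k"
          using qk \<alpha>[OF that(1)] by (simp add: progress_def cpoint_eq left_diff_distrib)
        ultimately show ?thesis by (auto simp: R_def E_def max_def ennreal_neg)
      qed
      have R0: "0 \<le> R j k" for j k by (simp add: R_def)
      have a0: "0 \<le> apoint j (\<alpha> j)" if "j \<in> {1..n}" for j
        using \<alpha>[OF that] that by (intro apoint_nonneg) auto
      have "(\<Sum>j=1..n. w j * rsos_completion n r q \<alpha> (\<lambda>k. p k \<omega>) j)
          \<le> (\<Sum>j=1..n. w j * (apoint j (\<alpha> j) + p j \<omega> + (\<Sum>k\<in>{1..n} - {j}. R j k)))"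
        unfolding R_def
        by (intro sum_mono mult_left_mono rsos_completion_le[OF _ \<alpha>] w x) auto
      then have "ennreal (\<Sum>j=1..n. w j * rsos_completion n r q \<alpha> (\<lambda>k. p k \<omega>) j)
          \<le> ennreal (\<Sum>j=1..n. w j * (apoint j (\<alpha> j) + p j \<omega> + (\<Sum>k\<in>{1..n} - {j}. R j k)))"
        by (rule ennreal_leI)
      also have "\<dots> = (\<Sum>j=1..n. ennreal (w j * (apoint j (\<alpha> j) + p j \<omega> + (\<Sum>k\<in>{1..n} - {j}. R j k))))"
        using w a0 x R0 by (intro sum_ennreal[symmetric]) (auto intro!: mult_nonneg_nonneg add_nonneg_nonneg sum_nonneg)
      also have "\<dots> = (\<Sum>j=1..n. ennreal (w j) * B j \<omega> \<alpha>)"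
      proof (rule sum.cong[OF refl])
        fix j assume j: "j \<in> {1..n}"
        have "ennreal (\<Sum>k\<in>{1..n} - {j}. R j k) = (\<Sum>k\<in>{1..n} - {j}. E j k \<omega> \<alpha>)"
          using R0 R[OF j] by (subst sum_ennreal[symmetric]) auto
        then have "ennreal (apoint j (\<alpha> j) + p j \<omega> + (\<Sum>k\<in>{1..n} - {j}. R j k)) = B j \<omega> \<alpha>"
          using a0[OF j] x[OF j] \<alpha>[OF j] sum_nonneg[of "{1..n} - {j}" "R j"] R0
          by (simp add: B_def cpoint_eq)
        then show "ennreal (w j * (apoint j (\<alpha> j) + p j \<omega> + (\<Sum>k\<in>{1..n} - {j}. R j k)))
            = ennreal (w j) * B j \<omega> \<alpha>"
          using w[OF j] by (simp add: ennreal_mult')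
      qed
      finally show ?case by (simp add: \<omega>_\<alpha>_def)
    qed
  qed
  also have "\<dots> = (\<Sum>j=1..n. ennreal (w j) * (\<integral>\<^sup>+z. B j (fst z) (snd z) \<partial>(M \<Otimes>\<^sub>M P)))"
    using B_meas by (subst nn_integral_sum) (auto intro!: sum.cong nn_integral_cmult)
  also have "\<dots> \<le> (\<Sum>j=1..n. ennreal (w j) * ennreal (c * (sp_mean_busy_time r q j + q j / 2)))"
    by (intro sum_mono mult_left_mono B_int) auto
  also have "\<dots> = (\<Sum>j=1..n. ennreal (w j * (c * (sp_mean_busy_time r q j + q j / 2))))"
    using w by (intro sum.cong) (auto simp: ennreal_mult')
  also have "\<dots> = ennreal (\<Sum>j=1..n. w j * (c * (sp_mean_busy_time r q j + q j / 2)))"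
    using w c_ge_1 nn_integral_busy_eq_mean_busy_time(2) q_pos[THEN less_imp_le]
    by (intro sum_ennreal) (auto intro!: mult_nonneg_nonneg add_nonneg_nonneg)
  also have "(\<Sum>j=1..n. w j * (c * (sp_mean_busy_time r q j + q j / 2)))
      = c * (\<Sum>j=1..n. w j * (sp_mean_busy_time r q j + q j / 2))"
    by (simp add: sum_distrib_left mult_ac)
  finally show ?thesis .
qed

end

subsection \<open>Lower bound for scheduling policies\<close>

text \<open>Abel summation, with differences taken only of the real weights: the induction peels off
  the full prefix with the smallest weight.\<close>

lemma sum_prefix_mono_ennreal:
  fixes a b :: "nat \<Rightarrow> ennreal" and v :: "nat \<Rightarrow> real"
  assumes "\<And>i. i \<in> {1..n} \<Longrightarrow> sum a {1..i} \<le> sum b {1..i}"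
    and "\<And>j. j \<in> {1..n} \<Longrightarrow> 0 \<le> v j"
    and "\<And>i j. 1 \<le> i \<Longrightarrow> i \<le> j \<Longrightarrow> j \<le> n \<Longrightarrow> v j \<le> v i"
  shows "(\<Sum>j\<in>{1..n}. ennreal (v j) * a j) \<le> (\<Sum>j\<in>{1..n}. ennreal (v j) * b j)"
  using assms
proof (induction n arbitrary: v)
  case (Suc n)
  let ?z = "v (Suc n)"
  have z: "0 \<le> ?z" using Suc.prems(2)[of "Suc n"] by simp
  have split: "(\<Sum>j\<in>{1..Suc n}. ennreal (v j) * g j)
      = (\<Sum>j\<in>{1..n}. ennreal (v j - ?z) * g j) + ennreal ?z * sum g {1..Suc n}" for g :: "nat \<Rightarrow> ennreal"
  proof -
    have "(\<Sum>j\<in>{1..Suc n}. ennreal (v j) * g j)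
        = (\<Sum>j\<in>{1..Suc n}. ennreal (v j - ?z) * g j + ennreal ?z * g j)"
    proof (rule sum.cong[OF refl])
      fix j assume "j \<in> {1..Suc n}"
      then have "ennreal (v j) = ennreal (v j - ?z) + ennreal ?z"
        using Suc.prems(3)[of j "Suc n"] z by (subst ennreal_plus[symmetric]) auto
      then show "ennreal (v j) * g j = ennreal (v j - ?z) * g j + ennreal ?z * g j"
        by (simp add: distrib_right)
    qed
    then show ?thesis by (simp add: sum.distrib sum_distrib_left distrib_left add_ac)
  qed
  have "(\<Sum>j\<in>{1..n}. ennreal (v j - ?z) * a j) \<le> (\<Sum>j\<in>{1..n}. ennreal (v j - ?z) * b j)"
    using Suc.prems by (intro Suc.IH) auto
  moreover have "ennreal ?z * sum a {1..Suc n} \<le> ennreal ?z * sum b {1..Suc n}"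
    using Suc.prems(1)[of "Suc n"] by (intro mult_left_mono) auto
  ultimately show ?case unfolding split by (rule add_mono)
qed simp

text \<open>The first job starts at \<open>l\<close> or later, hence all others at
  \<open>l + y i\<close> or later: the induction raises \<open>l\<close>. The quotient is the sum of
  \<open>y i * y j\<close> over unordered pairs.\<close>

lemma weighted_starts_ge:
  fixes s y :: "'b \<Rightarrow> real"
  assumes "sorted_wrt (\<lambda>i j. s i + y i \<le> s j) js" "distinct js"
    and "\<And>j. j \<in> set js \<Longrightarrow> l \<le> s j" "\<And>j. j \<in> set js \<Longrightarrow> 0 \<le> y j"
  shows "l * sum y (set js) + ((sum y (set js))\<^sup>2 - (\<Sum>j\<in>set js. (y j)\<^sup>2)) / 2
           \<le> (\<Sum>j\<in>set js. y j * s j)"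
  using assms
proof (induction js arbitrary: l)
  case (Cons i js)
  define Y where "Y = sum y (set js)"
  have "(l + y i) * Y + (Y\<^sup>2 - (\<Sum>j\<in>set js. (y j)\<^sup>2)) / 2 \<le> (\<Sum>j\<in>set js. y j * s j)"
    unfolding Y_def using Cons.prems by (intro Cons.IH) force+
  moreover have "l * y i \<le> y i * s i"
    using Cons.prems(3,4)[of i] by (simp add: mult.commute mult_right_mono)
  ultimately show ?case
    using Cons.prems(2) by (simp add: Y_def[symmetric] power2_sum algebra_simps add_divide_distrib diff_divide_distrib)
qed simp

section \<open>Runs of a policy and non-anticipation\<close>

lemma run_Suc: "run \<pi> u x (Suc m) = (let h = run \<pi> u x m in
    h @ [(fst (\<pi> u h), snd (\<pi> u h), x (fst (\<pi> u h)))])"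
  by (simp add: Let_def case_prod_beta)

declare run.simps(2) [simp del]

text \<open>As long as \<open>j\<close> has not been started, no decision has seen its processing
  time.\<close>

lemma run_fun_upd:
  "j \<notin> fst ` set (run \<pi> u x m) \<Longrightarrow> run \<pi> u (x(j := y)) m = run \<pi> u x m"
  by (induction m) (auto simp: run_Suc Let_def)

lemma map_of_run:
  assumes "j \<notin> fst ` set (run \<pi> u x m)" "fst (\<pi> u (run \<pi> u x m)) = j" "m < n"
  shows "map_of (run \<pi> u x n) j = Some (snd (\<pi> u (run \<pi> u x m)), x j)"
  using assms(3)
proof (induction n)
  case (Suc n)
  show ?case
  proof (cases "m = n")
    case True
    then have "map_of (run \<pi> u x n) j = None" using assms(1) by (simp add: map_of_eq_None_iff)
    then show ?thesis using True assms(2) by (auto simp: run_Suc Let_def map_add_def)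
  next
    case False
    then show ?thesis using Suc by (auto simp: run_Suc Let_def map_add_def)
  qed
qed simp

lemma run_first_occurrence:
  "j \<in> fst ` set (run \<pi> u x n)
    \<Longrightarrow> \<exists>m<n. j \<notin> fst ` set (run \<pi> u x m) \<and> fst (\<pi> u (run \<pi> u x m)) = j"
proof (induction n)
  case (Suc n)
  show ?case
  proof (cases "j \<in> fst ` set (run \<pi> u x n)")
    case True
    then show ?thesis using Suc.IH less_SucI by blast
  next
    case False
    then have "fst (\<pi> u (run \<pi> u x n)) = j" using Suc.prems by (auto simp: run_Suc Let_def)
    then show ?thesis using False by blast
  qed
qed simp

definition start_time :: "policy \<Rightarrow> real \<Rightarrow> (nat \<Rightarrow> real) \<Rightarrow> nat \<Rightarrow> nat \<Rightarrow> real" where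
  "start_time \<pi> u x n j = fst (the (map_of (run \<pi> u x n) j))"

text \<open>The start of \<open>j\<close> is decided on the history before its first occurrence,
  which does not depend on \<open>x j\<close>.\<close>

lemma start_time_fun_upd:
  assumes "j \<in> fst ` set (run \<pi> u x n)"
  shows "start_time \<pi> u (x(j := y)) n j = start_time \<pi> u x n j"
proof -
  obtain m where m: "m < n" "j \<notin> fst ` set (run \<pi> u x m)" "fst (\<pi> u (run \<pi> u x m)) = j"
    using run_first_occurrence[OF assms] by blast
  note eq = run_fun_upd[OF m(2), of y]
  show ?thesis
    using map_of_run[OF m(2,3,1)] map_of_run[of j \<pi> u "x(j := y)" m n] m
    by (simp add: start_time_def eq)
qed

lemma run_entry:
  assumes "distinct (map fst (run \<pi> u x n))" "j \<in> fst ` set (run \<pi> u x n)"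
  shows "completion \<pi> u x n j = start_time \<pi> u x n j + x j"
    and "(j, s, y) \<in> set (run \<pi> u x n) \<Longrightarrow> s = start_time \<pi> u x n j \<and> y = x j"
proof -
  obtain m where m: "m < n" "j \<notin> fst ` set (run \<pi> u x m)" "fst (\<pi> u (run \<pi> u x m)) = j"
    using run_first_occurrence[OF assms(2)] by blast
  note mo = map_of_run[OF m(2,3,1)]
  show "completion \<pi> u x n j = start_time \<pi> u x n j + x j"
    by (simp add: completion_def start_time_def mo)
  show "s = start_time \<pi> u x n j \<and> y = x j" if "(j, s, y) \<in> set (run \<pi> u x n)"
    using map_of_is_SomeI[OF assms(1) that] mo by (simp add: start_time_def)
qed

lemma scheduling_policy_start_time:
  assumes \<pi>: "scheduling_policy n r \<pi>" and u: "u \<in> {0..1}" and x: "\<And>j. j \<in> {1..n} \<Longrightarrow> 0 \<le> x j"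
  shows "j \<in> {1..n} \<Longrightarrow> completion \<pi> u x n j = start_time \<pi> u x n j + x j"
    and "j \<in> {1..n} \<Longrightarrow> r j \<le> start_time \<pi> u x n j"
    and "j \<in> {1..n} \<Longrightarrow> start_time \<pi> u (x(j := y)) n j = start_time \<pi> u x n j"
    and "B \<subseteq> {1..n} \<Longrightarrow> (\<And>j. j \<in> B \<Longrightarrow> l \<le> r j) \<Longrightarrow>
      l * sum x B + ((sum x B)\<^sup>2 - (\<Sum>j\<in>B. (x j)\<^sup>2)) / 2 \<le> (\<Sum>j\<in>B. x j * start_time \<pi> u x n j)"
proof -
  define h where "h = run \<pi> u x n"
  have h: "distinct (map fst h)" "fst ` set h = {1..n}" "\<And>j s y. (j, s, y) \<in> set h \<Longrightarrow> r j \<le> s"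
    "sorted_wrt (\<lambda>(i, s, y) (j, s', y'). s + y \<le> s') h"
  proof -
    have "\<forall>j\<in>{1..n}. 0 \<le> x j" using x by blast
    then have "distinct (map fst h) \<and> set (map fst h) = {1..n} \<and> (\<forall>(j, s, y)\<in>set h. r j \<le> s) \<and>
        sorted_wrt (\<lambda>(i, s, y) (j, s', y'). s + y \<le> s') h"
      using \<pi> u unfolding scheduling_policy_def h_def Let_def by blast
    then show "distinct (map fst h)" "fst ` set h = {1..n}" "\<And>j s y. (j, s, y) \<in> set h \<Longrightarrow> r j \<le> s"
      "sorted_wrt (\<lambda>(i, s, y) (j, s', y'). s + y \<le> s') h" by auto
  qed
  show "completion \<pi> u x n j = start_time \<pi> u x n j + x j" if "j \<in> {1..n}"
    using h that unfolding h_def by (intro run_entry(1)) auto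
  have entry: "s = start_time \<pi> u x n j \<and> y = x j" if "(j, s, y) \<in> set h" for j s y
    using h that unfolding h_def by (intro run_entry(2)) force+
  show r: "r j \<le> start_time \<pi> u x n j" if "j \<in> {1..n}" for j
  proof -
    have "j \<in> fst ` set h" using that h(2) by simp
    then obtain s y where "(j, s, y) \<in> set h" by force
    then show ?thesis using entry h(3) by blast
  qed
  show "start_time \<pi> u (x(j := y)) n j = start_time \<pi> u x n j" if "j \<in> {1..n}"
    using h that unfolding h_def by (intro start_time_fun_upd) auto
  show "l * sum x B + ((sum x B)\<^sup>2 - (\<Sum>j\<in>B. (x j)\<^sup>2)) / 2 \<le> (\<Sum>j\<in>B. x j * start_time \<pi> u x n j)"
    if B: "B \<subseteq> {1..n}" "\<And>j. j \<in> B \<Longrightarrow> l \<le> r j"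
  proof -
    \<comment> \<open>The jobs of \<open>B\<close> in the order of the schedule; a sublist inherits
      the sortedness of the whole run.\<close>
    define js where "js = filter (\<lambda>j. j \<in> B) (map fst h)"
    have set: "set js = B" using B h(2) by (auto simp: js_def)
    have "sorted_wrt (\<lambda>i j. start_time \<pi> u x n i + x i \<le> start_time \<pi> u x n j) (map fst h)"
      unfolding sorted_wrt_map
    proof (rule sorted_wrt_mono_rel[OF _ h(4)])
      fix a b assume "a \<in> set h" "b \<in> set h" "(\<lambda>(i, s, y) (j, s', y'). s + y \<le> s') a b"
      then show "start_time \<pi> u x n (fst a) + x (fst a) \<le> start_time \<pi> u x n (fst b)"
        using entry[of "fst a" "fst (snd a)" "snd (snd a)"] entry[of "fst b" "fst (snd b)" "snd (snd b)"]
        by (simp add: case_prod_beta)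
    qed
    then have "sorted_wrt (\<lambda>i j. start_time \<pi> u x n i + x i \<le> start_time \<pi> u x n j) js"
      unfolding js_def by (rule sorted_wrt_filter)
    moreover have "distinct js" using h(1) by (simp add: js_def)
    moreover have "l \<le> start_time \<pi> u x n j" "0 \<le> x j" if "j \<in> set js" for j
      using that B(1) order_trans[OF B(2)[of j] r[of j]] x[of j] unfolding set by auto
    ultimately show ?thesis using weighted_starts_ge[of "start_time \<pi> u x n" x js l] by (simp add: set)
  qed
qed

text \<open>\<open>G\<close> ignores coordinate \<open>j\<close>, so it factors out when that
  coordinate is integrated first.\<close>

lemma nn_integral_PiM_mult_indep:
  assumes "\<And>k. prob_space (N k)" "finite I" "j \<in> I"
    and G: "G \<in> borel_measurable (PiM I N)" and h [measurable]: "h \<in> borel_measurable (N j)"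
    and upd: "\<And>x y. x \<in> space (PiM I N) \<Longrightarrow> G (x(j := y)) = G x"
  shows "(\<integral>\<^sup>+x. h (x j) * G x \<partial>PiM I N) = (\<integral>\<^sup>+y. h y \<partial>N j) * (\<integral>\<^sup>+x. G x \<partial>PiM I N)"
proof -
  interpret product_prob_space N I
    using assms(1) by (rule product_prob_spaceI)
  note Nj = prob_space.emeasure_space_1[OF assms(1)[of j]]
  define J where "J = I - {j}"
  have J: "finite J" "j \<notin> J" "I = insert j J" using assms(2,3) by (auto simp: J_def)
  have "space (N j) \<noteq> {}" using Nj by auto
  then obtain y0 where y0: "y0 \<in> space (N j)" by blast
  have sp: "x(j := y) \<in> space (PiM I N)" if "x \<in> space (PiM J N)" "y \<in> space (N j)" for x y
    using that unfolding J(3) by (auto simp: space_PiM PiE_def extensional_def)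
  \<comment> \<open>Any fixed value in coordinate \<open>j\<close> serves; it turns \<open>G\<close>
    into a measurable function of the remaining coordinates.\<close>
  define G0 where "G0 = (\<lambda>x. G (x(j := y0)))"
  have const: "G (x(j := y)) = G0 x" if "x \<in> space (PiM J N)" for x y
    using upd[OF sp[OF that y0], of y] by (simp add: G0_def)
  have [measurable]: "G \<in> borel_measurable (PiM (insert j J) N)" using G J(3) by simp
  have [measurable]: "G0 \<in> borel_measurable (PiM J N)"
    unfolding G0_def using y0 by measurable
  have "(\<integral>\<^sup>+x. h (x j) * G x \<partial>PiM I N)
      = (\<integral>\<^sup>+x. \<integral>\<^sup>+y. h ((x(j := y)) j) * G (x(j := y)) \<partial>N j \<partial>PiM J N)"
    unfolding J(3) by (intro product_nn_integral_insert J) measurable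
  also have "\<dots> = (\<integral>\<^sup>+x. \<integral>\<^sup>+y. h y * G0 x \<partial>N j \<partial>PiM J N)"
    by (intro nn_integral_cong) (simp add: const)
  also have "\<dots> = (\<integral>\<^sup>+y. h y \<partial>N j) * (\<integral>\<^sup>+x. G0 x \<partial>PiM J N)"
    by (simp add: nn_integral_multc nn_integral_cmult)
  also have "(\<integral>\<^sup>+x. G0 x \<partial>PiM J N) = (\<integral>\<^sup>+x. \<integral>\<^sup>+y. G (x(j := y)) \<partial>N j \<partial>PiM J N)"
    by (intro nn_integral_cong) (simp add: const Nj)
  also have "\<dots> = (\<integral>\<^sup>+x. G x \<partial>PiM I N)"
    using G unfolding J(3) by (intro product_nn_integral_insert[symmetric] J)
  finally show ?thesis .
qed

text \<open>Removes the subtracted squares from \<open>weighted_starts_ge\<close>: the off-diagonal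
  sum is nonnegative for nonnegative \<open>z\<close>, and its expectation involves no second
  moments of processing times.\<close>

lemma sum_power2_eq_offdiag:
  fixes z :: "'b \<Rightarrow> real"
  assumes "finite B"
  shows "(sum z B)\<^sup>2 = (\<Sum>j\<in>B. (z j)\<^sup>2) + (\<Sum>i\<in>B. \<Sum>k\<in>B - {i}. z i * z k)"
proof -
  have "(sum z B)\<^sup>2 = (\<Sum>i\<in>B. \<Sum>k\<in>B. z i * z k)" by (simp add: power2_eq_square sum_product)
  also have "\<dots> = (\<Sum>i\<in>B. (z i)\<^sup>2 + (\<Sum>k\<in>B - {i}. z i * z k))"
    using assms by (intro sum.cong refl) (simp add: sum.remove power2_eq_square)
  finally show ?thesis by (simp add: sum.distrib)
qed

section \<open>Busy periods of job prefixes\<close>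

context preemptive_schedule
begin

lemma pending_iff_apoint: "k \<in> {1..n} \<Longrightarrow> pending k t \<longleftrightarrow> r k \<le> t \<and> t < apoint k 1"
  using r_nonneg[of k] apoint_le_iff[of k 1 t] by (auto simp: pending_iff)

text \<open>The busy periods of the first \<open>i\<close> jobs are handled one after the other. A time is a
  boundary between busy periods if all jobs released before it are finished; the last busy period
  before such a time starts at the latest release date that is again a boundary.\<close>

lemma busy_time_prefix_le:
  fixes e :: "nat \<Rightarrow> ennreal"
  assumes i: "i \<le> n"
    and e: "\<And>B l. B \<subseteq> {1..i} \<Longrightarrow> 0 \<le> l \<Longrightarrow> (\<And>j. j \<in> B \<Longrightarrow> l \<le> r j)
      \<Longrightarrow> ennreal (l * sum q B + (sum q B)\<^sup>2 / 2) \<le> sum e B"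
  shows "(\<Sum>j\<in>{1..i}. ennreal (q j * sp_mean_busy_time r q j)) \<le> sum e {1..i}"
proof -
  define U where "U = (\<Union>k\<in>{1..i}. busy k)"
  define clean where "clean = (\<lambda>u. \<forall>k\<in>{1..i}. r k < u \<longrightarrow> apoint k 1 \<le> u)"
  have n: "k \<in> {1..n}" if "k \<in> {1..i}" for k using that i by auto
  have U: "t \<in> U \<longleftrightarrow> (\<exists>k\<in>{1..i}. r k \<le> t \<and> t < apoint k 1)" for t
    unfolding U_def UN_sp_busy using pending_iff_apoint[OF n] by auto
  have [measurable]: "U \<in> sets borel" unfolding U_def by auto
  \<comment> \<open>Induction on the number of jobs released before the boundary \<open>u\<close>:
    the last busy period is split off, and the part before its start \<open>l\<close> has fewer
    jobs, since the one released at \<open>l\<close> drops out.\<close>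
  have main: "(\<integral>\<^sup>+t. ennreal t * indicator (U \<inter> {..<u}) t \<partial>lborel) \<le> sum e {j\<in>{1..i}. r j < u}"
    if "clean u" for u
    using that
  proof (induction "card {j\<in>{1..i}. r j < u}" arbitrary: u rule: less_induct)
    case less
    define B where "B = {j\<in>{1..i}. r j < u}"
    show ?case
    proof (cases "B = {}")
      case True
      then have "U \<inter> {..<u} = {}" unfolding B_def set_eq_iff Int_iff U by force
      then show ?thesis by simp
    next
      case False
      define L where "L = {r j |j. j \<in> B \<and> clean (r j)}"
      have finB: "finite B" by (simp add: B_def)
      have finL: "finite L"
      proof (rule finite_subset)
        show "L \<subseteq> r ` B" by (auto simp: L_def)
      qed (simp add: finB)
      have "L \<noteq> {}"
      proof -
        obtain j where "j \<in> B" "\<forall>k\<in>B. r j \<le> r k"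
          using ex_min_if_finite[of "r ` B"] finB False by (metis arg_min_if_finite(1) arg_min_least)
        \<comment> \<open>None of the first \<open>i\<close> jobs is released before the earliest of
          their release dates, so that date is a boundary.\<close>
        then have "clean (r j)" by (force simp: clean_def B_def)
        then show ?thesis using \<open>j \<in> B\<close> by (auto simp: L_def)
      qed
      define l where "l = Max L"
      have "l \<in> L" unfolding l_def using finL \<open>L \<noteq> {}\<close> by (rule Max_in)
      then obtain j0 where j0: "j0 \<in> B" "l = r j0" "clean l" by (auto simp: L_def)
      have l: "0 \<le> l" "l < u" using j0 r_nonneg[OF n, of j0] by (auto simp: B_def)
      have lmax: "\<not> clean (r j)" if "j \<in> B" "l < r j" for j
        using Max_ge[OF finL, of "r j"] that by (auto simp: L_def l_def)
      define B' where "B' = {j\<in>{1..i}. r j < l}"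
      define B'' where "B'' = {j\<in>{1..i}. l \<le> r j \<and> r j < u}"
      have Bsplit: "B = B' \<union> B''" "B' \<inter> B'' = {}" "finite B'" "finite B''" "B'' \<subseteq> {1..i}"
        using l by (auto simp: B_def B'_def B''_def)
      have "B' \<subset> B" using j0 l by (auto simp: B_def B'_def)
      then have "card B' < card B" by (rule psubset_card_mono[OF finB])
      then have IH: "(\<integral>\<^sup>+t. ennreal t * indicator (U \<inter> {..<l}) t \<partial>lborel) \<le> sum e B'"
        unfolding B_def B'_def using less.hyps j0(3) by blast
      define Q where "Q = sum q B''"
      have Q0: "0 \<le> Q" unfolding Q_def using q_pos n Bsplit(5) by (intro sum_nonneg) (force intro: less_imp_le)
      \<comment> \<open>Between \<open>l\<close> and \<open>t\<close> the prefix is processed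
        without a gap and only jobs of \<open>B''\<close> receive work, so at most \<open>Q\<close>
        time has elapsed.\<close>
      have tail: "t \<in> {l..l + Q}" if t: "t \<in> U" "l \<le> t" "t < u" for t
      proof -
        \<comment> \<open>A gap at \<open>s\<close> would make the first release after
          \<open>s\<close> a boundary later than \<open>l\<close>, against the choice of
          \<open>l\<close>.\<close>
        have full: "s \<in> U" if s: "l \<le> s" "s < t" for s
        proof (rule ccontr)
          assume "s \<notin> U"
          define R where "R = {r k |k. k \<in> {1..i} \<and> s < r k \<and> r k \<le> t}"
          obtain k where k: "k \<in> {1..i}" "r k \<le> t" "t < apoint k 1" using t(1) U by blast
          have "s < r k" using \<open>s \<notin> U\<close> k s by (force simp: U)
          then have "r k \<in> R" using k by (auto simp: R_def)
          have "finite R"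
          proof (rule finite_subset)
            show "R \<subseteq> r ` {1..i}" by (auto simp: R_def)
          qed simp
          then have "Min R \<in> R" using \<open>r k \<in> R\<close> by (intro Min_in) auto
          then obtain j where j: "j \<in> {1..i}" "Min R = r j" "s < r j" "r j \<le> t" by (auto simp: R_def)
          have "clean (r j)"
            unfolding clean_def
          proof (intro ballI impI)
            fix k' assume k': "k' \<in> {1..i}" "r k' < r j"
            then have "r k' \<notin> R" using Min_le[OF \<open>finite R\<close>, of "r k'"] j by auto
            then have "\<not> s < r k'" using k' j(4) unfolding R_def by auto
            then have "r k' \<le> s" by simp
            then have "apoint k' 1 \<le> s" using \<open>s \<notin> U\<close> k' by (force simp: U)
            then show "apoint k' 1 \<le> r j" using j by simp
          qed
          then show False using lmax[of j] j s t by (auto simp: B_def)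
        qed
        have "t - l = (\<Sum>k\<in>{1..i}. work k t - work k l)"
          using full l t unfolding U_def UN_sp_busy by (intro sum_sp_work_diff_eq[symmetric]) auto
        also have "\<dots> \<le> (\<Sum>k\<in>{1..i}. if k \<in> B'' then q k else 0)"
        proof (rule sum_mono)
          fix k assume k: "k \<in> {1..i}"
          note kn = n[OF k]
          \<comment> \<open>A job released before \<open>l\<close> is finished at the boundary
            \<open>l\<close>; one released at \<open>u\<close> or later has received no work by
            \<open>t\<close>.\<close>
          consider "r k < l" | "k \<in> B''" | "u \<le> r k" using k by (force simp: B''_def)
          then show "work k t - work k l \<le> (if k \<in> B'' then q k else 0)"
          proof cases
            case 1
            then have "q k \<le> work k l" using j0(3) k l apoint_le_iff[OF kn, of 1 l] by (auto simp: clean_def)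
            then show ?thesis using 1 work_le[OF kn, of t] by (auto simp: B''_def)
          next
            case 2
            then show ?thesis using work_le[OF kn, of t] sp_work_nonneg[of r q k l] by auto
          next
            case 3
            then show ?thesis using t work_before_release[OF kn, of t] sp_work_nonneg[of r q k l] by (auto simp: B''_def)
          qed
        qed
        also have "\<dots> = Q"
          unfolding Q_def using Bsplit(5) by (simp add: sum.inter_restrict[symmetric] Int_absorb1)
        finally show ?thesis using t by auto
      qed
      have "(\<integral>\<^sup>+t. ennreal t * indicator (U \<inter> {..<u}) t \<partial>lborel)
          \<le> (\<integral>\<^sup>+t. ennreal t * indicator (U \<inter> {..<l}) t + ennreal t * indicator {l..l + Q} t \<partial>lborel)"
      proof (intro nn_integral_mono)
        fix t :: real
        show "ennreal t * indicator (U \<inter> {..<u}) t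
            \<le> ennreal t * indicator (U \<inter> {..<l}) t + ennreal t * indicator {l..l + Q} t"
          using tail[of t] by (cases "t \<in> U \<and> t < u"; cases "t < l") auto
      qed
      also have "\<dots> = (\<integral>\<^sup>+t. ennreal t * indicator (U \<inter> {..<l}) t \<partial>lborel) + ennreal (l * Q + Q\<^sup>2 / 2)"
        by (subst nn_integral_add) (auto simp: nn_integral_Icc_id[OF l(1) Q0])
      also have "\<dots> \<le> sum e B' + sum e B''"
        unfolding Q_def by (intro add_mono IH e Bsplit l) (simp add: B''_def)
      also have "\<dots> = sum e B" using Bsplit by (simp add: sum.union_disjoint)
      finally show ?thesis by (simp add: B_def)
    qed
  qed
  \<comment> \<open>A time strictly after all releases and completions is a boundary beyond all busy
    periods.\<close>
  define u where "u = 1 + (\<Sum>k\<in>{1..i}. r k + apoint k 1)"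
  have "r k < u \<and> apoint k 1 < u" if k: "k \<in> {1..i}" for k
  proof -
    have "r k + apoint k 1 \<le> (\<Sum>k\<in>{1..i}. r k + apoint k 1)"
      using k r_nonneg[OF n] apoint_nonneg[OF n, of _ 1] by (intro member_le_sum) auto
    then show ?thesis using r_nonneg[OF n[OF k]] apoint_nonneg[OF n[OF k], of 1] by (simp add: u_def)
  qed
  then have "clean u" "{j\<in>{1..i}. r j < u} = {1..i}" "U \<inter> {..<u} = U"
    by (force simp: clean_def, force, force simp: U set_eq_iff)
  then have "(\<integral>\<^sup>+t. ennreal t * indicator U t \<partial>lborel) \<le> sum e {1..i}" using main[of u] by simp
  moreover have "(\<integral>\<^sup>+t. ennreal t * indicator U t \<partial>lborel) = (\<Sum>j\<in>{1..i}. ennreal (q j * sp_mean_busy_time r q j))"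
  proof -
    have "disjoint_family_on busy {1..i}"
      unfolding disjoint_family_on_def using sp_busy_disjoint by auto
    then have ind: "indicator U t = (\<Sum>k\<in>{1..i}. indicator (busy k) t :: ennreal)" for t
      unfolding U_def by (intro indicator_UN_disjoint) auto
    have "(\<integral>\<^sup>+t. ennreal t * indicator U t \<partial>lborel)
        = (\<integral>\<^sup>+t. (\<Sum>k\<in>{1..i}. ennreal t * indicator (busy k) t) \<partial>lborel)"
      by (simp add: ind sum_distrib_left)
    also have "\<dots> = (\<Sum>k\<in>{1..i}. \<integral>\<^sup>+t. ennreal t * indicator (busy k) t \<partial>lborel)"
      by (rule nn_integral_sum) measurable
    also have "\<dots> = (\<Sum>k\<in>{1..i}. ennreal (q k * sp_mean_busy_time r q k))"
      using n by (intro sum.cong nn_integral_busy_eq_mean_busy_time) auto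
    finally show ?thesis .
  qed
  ultimately show ?thesis by simp
qed

section \<open>Expected start times for a fixed seed\<close>

context
  fixes \<pi> :: policy and u :: real and \<mu> :: "nat \<Rightarrow> real measure"
  assumes \<pi>: "scheduling_policy n r \<pi>" and u: "u \<in> {0..1}"
    and \<mu>: "\<And>k. prob_space (\<mu> k)" and sets_\<mu>: "\<And>k. sets (\<mu> k) = sets borel"
    and mean_\<mu>: "\<And>k. k \<in> {1..n} \<Longrightarrow> (\<integral>\<^sup>+y. ennreal y \<partial>\<mu> k) = ennreal (q k)"
begin

text \<open>Processing times are nonnegative only almost everywhere, and nothing is known about the
  behaviour of a policy on negative ones; hence the truncation.\<close>

definition nonneg_part :: "(nat \<Rightarrow> real) \<Rightarrow> nat \<Rightarrow> real" where
  "nonneg_part x = (\<lambda>k\<in>{1..n}. max 0 (x k))"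

definition policy_start :: "nat \<Rightarrow> (nat \<Rightarrow> real) \<Rightarrow> real" where
  "policy_start j x = start_time \<pi> u (nonneg_part x) n j"

definition mean_start :: "nat \<Rightarrow> ennreal" where
  "mean_start j = (\<integral>\<^sup>+x. ennreal (policy_start j x) \<partial>PiM {1..n} \<mu>)"

lemma nonneg_part: "k \<in> {1..n} \<Longrightarrow> nonneg_part x k = max 0 (x k)"
  by (simp add: nonneg_part_def)

lemma policy_start_props:
  shows policy_start_completion: "j \<in> {1..n} \<Longrightarrow> completion \<pi> u (nonneg_part x) n j = policy_start j x + max 0 (x j)"
    and policy_start_ge: "j \<in> {1..n} \<Longrightarrow> r j \<le> policy_start j x"
    and policy_start_upd: "j \<in> {1..n} \<Longrightarrow> policy_start j (x(j := y)) = policy_start j x"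
    and policy_start_sum: "B \<subseteq> {1..n} \<Longrightarrow> (\<And>j. j \<in> B \<Longrightarrow> l \<le> r j) \<Longrightarrow>
      l * (\<Sum>j\<in>B. max 0 (x j)) + ((\<Sum>j\<in>B. max 0 (x j))\<^sup>2 - (\<Sum>j\<in>B. (max 0 (x j))\<^sup>2)) / 2
        \<le> (\<Sum>j\<in>B. max 0 (x j) * policy_start j x)"
proof -
  have pos: "0 \<le> nonneg_part x j" if "j \<in> {1..n}" for j using that by (simp add: nonneg_part)
  note sp = scheduling_policy_start_time[where x="nonneg_part x", OF \<pi> u pos]
  show "completion \<pi> u (nonneg_part x) n j = policy_start j x + max 0 (x j)" if "j \<in> {1..n}"
    using sp(1)[of j] that by (simp add: policy_start_def nonneg_part)
  show "r j \<le> policy_start j x" if "j \<in> {1..n}" using sp(2)[of j] that by (simp add: policy_start_def)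
  show "policy_start j (x(j := y)) = policy_start j x" if "j \<in> {1..n}"
  proof -
    have "nonneg_part (x(j := y)) = (nonneg_part x)(j := max 0 y)"
      using that by (auto simp: nonneg_part_def fun_eq_iff)
    then show ?thesis using sp(3)[of j] that by (simp add: policy_start_def)
  qed
  show "l * (\<Sum>j\<in>B. max 0 (x j)) + ((\<Sum>j\<in>B. max 0 (x j))\<^sup>2 - (\<Sum>j\<in>B. (max 0 (x j))\<^sup>2)) / 2
        \<le> (\<Sum>j\<in>B. max 0 (x j) * policy_start j x)"
    if B: "B \<subseteq> {1..n}" and l: "\<And>j. j \<in> B \<Longrightarrow> l \<le> r j"
  proof -
    have eq: "(\<Sum>j\<in>B. g (nonneg_part x j) j) = (\<Sum>j\<in>B. g (max 0 (x j)) j)" for g :: "real \<Rightarrow> nat \<Rightarrow> real"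
      using B by (intro sum.cong) (auto simp: nonneg_part)
    show ?thesis
      using sp(4)[OF _ B l] eq[of "\<lambda>a j. a"] eq[of "\<lambda>a j. a\<^sup>2"] eq[of "\<lambda>a j. a * policy_start j x"]
      by (simp add: policy_start_def)
  qed
qed

lemma component_measurable: "k \<in> {1..n} \<Longrightarrow> (\<lambda>x. x k) \<in> borel_measurable (PiM {1..n} \<mu>)"
  using measurable_component_singleton[of k "{1..n}" \<mu>] by (simp add: sets_\<mu> cong: measurable_cong_sets)

text \<open>\<open>scheduling_policy\<close> grants measurability of completion times; start times
  are recovered by subtracting the processing time.\<close>

lemma policy_start_measurable:
  assumes j: "j \<in> {1..n}"
  shows "policy_start j \<in> borel_measurable (PiM {1..n} \<mu>)"
proof -
  have "(\<lambda>x. (u, nonneg_part x)) \<in> PiM {1..n} \<mu> \<rightarrow>\<^sub>M borel \<Otimes>\<^sub>M PiM {1..n} (\<lambda>_. borel)"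
    unfolding nonneg_part_def
    by (intro measurable_Pair measurable_const measurable_restrict borel_measurable_max component_measurable) auto
  moreover have "(\<lambda>(u, x). completion \<pi> u x n j) \<in> borel_measurable (borel \<Otimes>\<^sub>M PiM {1..n} (\<lambda>_. borel))"
    using \<pi> j by (auto simp: scheduling_policy_def)
  ultimately have "(\<lambda>x. completion \<pi> u (nonneg_part x) n j) \<in> borel_measurable (PiM {1..n} \<mu>)"
    using measurable_compose by fastforce
  then have "(\<lambda>x. completion \<pi> u (nonneg_part x) n j - max 0 (x j)) \<in> borel_measurable (PiM {1..n} \<mu>)"
    using component_measurable[OF j] by measurable
  then show ?thesis using j by (simp add: policy_start_completion)
qed

text \<open>By \<open>policy_start_upd\<close> the start of \<open>j\<close> is independent of its
  processing time, so the expectation of the product factorizes.\<close>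

lemma nn_integral_indep_start:
  assumes j: "j \<in> {1..n}"
  shows "(\<integral>\<^sup>+x. ennreal (x j) * ennreal (policy_start j x) \<partial>PiM {1..n} \<mu>) = ennreal (q j) * mean_start j"
proof -
  have "(\<integral>\<^sup>+x. ennreal (x j) * ennreal (policy_start j x) \<partial>PiM {1..n} \<mu>)
      = (\<integral>\<^sup>+y. ennreal y \<partial>\<mu> j) * (\<integral>\<^sup>+x. ennreal (policy_start j x) \<partial>PiM {1..n} \<mu>)"
    using j policy_start_measurable[OF j]
    by (intro nn_integral_PiM_mult_indep[where h=ennreal] \<mu>)
       (auto simp: policy_start_upd sets_\<mu> cong: measurable_cong_sets)
  then show ?thesis using j by (simp add: mean_\<mu> mean_start_def)
qed

lemma nn_integral_component: "k \<in> {1..n} \<Longrightarrow> (\<integral>\<^sup>+x. ennreal (x k) \<partial>PiM {1..n} \<mu>) = ennreal (q k)"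
proof -
  assume k: "k \<in> {1..n}"
  interpret product_prob_space \<mu> "{1..n}" using \<mu> by (rule product_prob_spaceI)
  have "(\<integral>\<^sup>+y. ennreal y \<partial>distr (PiM {1..n} \<mu>) (\<mu> k) (\<lambda>x. x k)) = (\<integral>\<^sup>+x. ennreal (x k) \<partial>PiM {1..n} \<mu>)"
    by (intro nn_integral_distr measurable_component_singleton[OF k])
       (simp add: sets_\<mu> cong: measurable_cong_sets)
  then show ?thesis by (simp only: PiM_component[OF k] mean_\<mu>[OF k])
qed

lemma nn_integral_two_components:
  assumes "i \<in> {1..n}" "k \<in> {1..n}" "i \<noteq> k"
  shows "(\<integral>\<^sup>+x. ennreal (x i) * ennreal (x k) \<partial>PiM {1..n} \<mu>) = ennreal (q i) * ennreal (q k)"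
proof -
  have "(\<integral>\<^sup>+x. ennreal (x i) * ennreal (x k) \<partial>PiM {1..n} \<mu>)
      = (\<integral>\<^sup>+y. ennreal y \<partial>\<mu> i) * (\<integral>\<^sup>+x. ennreal (x k) \<partial>PiM {1..n} \<mu>)"
    using assms component_measurable[of k]
    by (intro nn_integral_PiM_mult_indep[where h=ennreal] \<mu>)
       (auto simp: sets_\<mu> cong: measurable_cong_sets)
  then show ?thesis by (simp only: mean_\<mu>[OF assms(1)] nn_integral_component[OF assms(2)])
qed

text \<open>The expectation of \<open>policy_start_sum\<close>. Independence turns products of
  distinct processing times into products of means; adding \<open>(q j)\<^sup>2 / 2\<close> for each
  job on both sides completes the square of \<open>sum q B\<close>.\<close>

lemma mean_start_set_bound:
  assumes B: "B \<subseteq> {1..n}" and l: "0 \<le> l" "\<And>j. j \<in> B \<Longrightarrow> l \<le> r j"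
  shows "ennreal (l * sum q B + (sum q B)\<^sup>2 / 2) \<le> (\<Sum>j\<in>B. ennreal (q j) * (mean_start j + ennreal (q j / 2)))"
proof -
  let ?N = "PiM {1..n} \<mu>"
  have fin: "finite B" using B finite_subset by blast
  have n: "j \<in> {1..n}" if "j \<in> B" for j using that B by blast
  have q0: "0 \<le> q j" if "j \<in> B" for j using q_pos[OF n[OF that]] by simp
  \<comment> \<open>All terms are nonnegative, so the bound passes to \<open>ennreal\<close>; it is
    applied to the realized processing times and to their means.\<close>
  have offdiag: "ennreal (l * sum z B + (\<Sum>i\<in>B. \<Sum>k\<in>B - {i}. z i * z k) / 2)
      = ennreal l * (\<Sum>j\<in>B. ennreal (z j)) + (\<Sum>i\<in>B. \<Sum>k\<in>B - {i}. ennreal (z i) * ennreal (z k)) * ennreal (1/2)"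
    if z: "\<And>j. j \<in> B \<Longrightarrow> 0 \<le> z j" for z
  proof -
    have "(\<Sum>i\<in>B. \<Sum>k\<in>B - {i}. ennreal (z i) * ennreal (z k)) = ennreal (\<Sum>i\<in>B. \<Sum>k\<in>B - {i}. z i * z k)"
    proof -
      have "(\<Sum>i\<in>B. \<Sum>k\<in>B - {i}. ennreal (z i) * ennreal (z k)) = (\<Sum>i\<in>B. ennreal (\<Sum>k\<in>B - {i}. z i * z k))"
        using z by (intro sum.cong refl, subst sum_ennreal[symmetric]) (auto simp: ennreal_mult)
      also have "\<dots> = ennreal (\<Sum>i\<in>B. \<Sum>k\<in>B - {i}. z i * z k)"
        using z by (intro sum_ennreal sum_nonneg) auto
      finally show ?thesis .
    qed
    moreover have "(\<Sum>j\<in>B. ennreal (z j)) = ennreal (sum z B)" using z by (intro sum_ennreal) auto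
    moreover have "0 \<le> (\<Sum>i\<in>B. \<Sum>k\<in>B - {i}. z i * z k)" "0 \<le> sum z B"
      using z by (auto intro!: sum_nonneg mult_nonneg_nonneg)
    ultimately show ?thesis
      using l(1) by (subst ennreal_plus) (auto simp: ennreal_mult[symmetric] simp del: ennreal_half intro!: arg_cong[of _ _ ennreal])
  qed
  have pw: "ennreal l * (\<Sum>j\<in>B. ennreal (x j)) + (\<Sum>i\<in>B. \<Sum>k\<in>B - {i}. ennreal (x i) * ennreal (x k)) * ennreal (1/2)
      \<le> (\<Sum>j\<in>B. ennreal (x j) * ennreal (policy_start j x))" for x
  proof -
    define z where "z = (\<lambda>j. max 0 (x j))"
    have z: "0 \<le> z j" "ennreal (x j) = ennreal (z j)" for j by (auto simp: z_def max_def ennreal_neg)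
    have "l * sum z B + (\<Sum>i\<in>B. \<Sum>k\<in>B - {i}. z i * z k) / 2 \<le> (\<Sum>j\<in>B. z j * policy_start j x)"
      using policy_start_sum[OF B l(2), of x] sum_power2_eq_offdiag[OF fin, of z] by (simp add: z_def)
    then have "ennreal (l * sum z B + (\<Sum>i\<in>B. \<Sum>k\<in>B - {i}. z i * z k) / 2) \<le> ennreal (\<Sum>j\<in>B. z j * policy_start j x)"
      by (rule ennreal_leI)
    also have "ennreal (\<Sum>j\<in>B. z j * policy_start j x) = (\<Sum>j\<in>B. ennreal (z j) * ennreal (policy_start j x))"
    proof -
      have "0 \<le> policy_start j x" if "j \<in> B" for j using policy_start_ge[OF n[OF that], of x] l that by (meson order_trans)
      then show ?thesis using z by (simp add: sum_ennreal[symmetric] ennreal_mult)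
    qed
    finally show ?thesis using offdiag[of z] z by simp
  qed
  have "ennreal (l * sum q B + (sum q B)\<^sup>2 / 2)
      = ennreal (l * sum q B + (\<Sum>i\<in>B. \<Sum>k\<in>B - {i}. q i * q k) / 2) + ennreal (\<Sum>j\<in>B. (q j)\<^sup>2 / 2)"
    unfolding sum_power2_eq_offdiag[OF fin]
    using q0 l(1) by (subst ennreal_plus[symmetric])
      (auto intro!: add_nonneg_nonneg mult_nonneg_nonneg sum_nonneg divide_nonneg_nonneg
         simp: add_divide_distrib sum_divide_distrib add_ac)
  also have "ennreal (l * sum q B + (\<Sum>i\<in>B. \<Sum>k\<in>B - {i}. q i * q k) / 2)
      = ennreal l * (\<Sum>j\<in>B. ennreal (q j)) + (\<Sum>i\<in>B. \<Sum>k\<in>B - {i}. ennreal (q i) * ennreal (q k)) * ennreal (1/2)"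
    by (rule offdiag[OF q0])
  also have "\<dots> = (\<integral>\<^sup>+x. ennreal l * (\<Sum>j\<in>B. ennreal (x j))
        + (\<Sum>i\<in>B. \<Sum>k\<in>B - {i}. ennreal (x i) * ennreal (x k)) * ennreal (1/2) \<partial>?N)"
  proof -
    have 1: "(\<integral>\<^sup>+x. (\<Sum>j\<in>B. ennreal (x j)) \<partial>?N) = (\<Sum>j\<in>B. ennreal (q j))"
      by (subst nn_integral_sum) (intro measurable_compose[OF _ measurable_ennreal] component_measurable n, assumption,
          intro sum.cong refl nn_integral_component n)
    have 2: "(\<integral>\<^sup>+x. (\<Sum>i\<in>B. \<Sum>k\<in>B - {i}. ennreal (x i) * ennreal (x k)) \<partial>?N)
        = (\<Sum>i\<in>B. \<Sum>k\<in>B - {i}. ennreal (q i) * ennreal (q k))"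
    proof -
      have m: "(\<lambda>x. ennreal (x i) * ennreal (x k)) \<in> borel_measurable ?N" if "i \<in> B" "k \<in> B" for i k
        using component_measurable[OF n[OF that(1)]] component_measurable[OF n[OF that(2)]] by measurable
      have "(\<integral>\<^sup>+x. (\<Sum>i\<in>B. \<Sum>k\<in>B - {i}. ennreal (x i) * ennreal (x k)) \<partial>?N)
          = (\<Sum>i\<in>B. \<integral>\<^sup>+x. (\<Sum>k\<in>B - {i}. ennreal (x i) * ennreal (x k)) \<partial>?N)"
        by (intro nn_integral_sum borel_measurable_sum m) auto
      also have "\<dots> = (\<Sum>i\<in>B. \<Sum>k\<in>B - {i}. \<integral>\<^sup>+x. ennreal (x i) * ennreal (x k) \<partial>?N)"
        by (intro sum.cong refl nn_integral_sum m) auto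
      also have "\<dots> = (\<Sum>i\<in>B. \<Sum>k\<in>B - {i}. ennreal (q i) * ennreal (q k))"
        by (intro sum.cong refl nn_integral_two_components n) auto
      finally show ?thesis .
    qed
    have m1: "(\<lambda>x. \<Sum>j\<in>B. ennreal (x j)) \<in> borel_measurable ?N"
      by (intro borel_measurable_sum measurable_compose[OF _ measurable_ennreal] component_measurable n)
    have m2: "(\<lambda>x. \<Sum>i\<in>B. \<Sum>k\<in>B - {i}. ennreal (x i) * ennreal (x k)) \<in> borel_measurable ?N"
      by (intro borel_measurable_sum borel_measurable_times_ennreal measurable_compose[OF _ measurable_ennreal]
          component_measurable n) auto
    show ?thesis
      unfolding 1[symmetric] 2[symmetric] nn_integral_cmult[OF m1, symmetric] nn_integral_multc[OF m2, symmetric]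
      by (intro nn_integral_add[symmetric] borel_measurable_times_ennreal borel_measurable_const m1 m2)
  qed
  also have "\<dots> \<le> (\<integral>\<^sup>+x. (\<Sum>j\<in>B. ennreal (x j) * ennreal (policy_start j x)) \<partial>?N)"
    by (intro nn_integral_mono pw)
  also have "\<dots> = (\<Sum>j\<in>B. \<integral>\<^sup>+x. ennreal (x j) * ennreal (policy_start j x) \<partial>?N)"
    by (intro nn_integral_sum borel_measurable_times_ennreal measurable_compose[OF _ measurable_ennreal]
        component_measurable policy_start_measurable n)
  also have "\<dots> = (\<Sum>j\<in>B. ennreal (q j) * mean_start j)"
    by (intro sum.cong refl nn_integral_indep_start n)
  also have "ennreal (\<Sum>j\<in>B. (q j)\<^sup>2 / 2) = (\<Sum>j\<in>B. ennreal (q j) * ennreal (q j / 2))"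
    using q0 by (subst sum_ennreal[symmetric])
      (auto intro!: sum.cong simp: ennreal_mult[symmetric] power2_eq_square)
  finally show ?thesis by (simp add: distrib_left sum.distrib)
qed

text \<open>The ratios \<open>w j / q j\<close> are nonincreasing weights. On each prefix
  \<open>busy_time_prefix_le\<close> and \<open>mean_start_set_bound\<close> compare busy times with
  mean starts plus \<open>q j / 2\<close>; a further \<open>q j / 2\<close> turns these into mean
  completion times.\<close>

lemma mean_busy_time_le_policy:
  assumes w: "\<And>j. j \<in> {1..n} \<Longrightarrow> 0 \<le> w j"
    and w_mono: "\<And>i j. 1 \<le> i \<Longrightarrow> i \<le> j \<Longrightarrow> j \<le> n \<Longrightarrow> w j / q j \<le> w i / q i"
    and \<mu>_nonneg: "\<And>k. k \<in> {1..n} \<Longrightarrow> AE y in \<mu> k. 0 \<le> y"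
  shows "ennreal (\<Sum>j=1..n. w j * (sp_mean_busy_time r q j + q j / 2))
    \<le> (\<integral>\<^sup>+x. ennreal (\<Sum>j=1..n. w j * completion \<pi> u x n j) \<partial>PiM {1..n} \<mu>)"
proof -
  let ?N = "PiM {1..n} \<mu>"
  have M0: "0 \<le> sp_mean_busy_time r q j" if "j \<in> {1..n}" for j
    by (rule nn_integral_busy_eq_mean_busy_time(2)[OF that])
  have "(\<Sum>j\<in>{1..n}. ennreal (w j / q j) * ennreal (q j * sp_mean_busy_time r q j))
      \<le> (\<Sum>j\<in>{1..n}. ennreal (w j / q j) * (ennreal (q j) * (mean_start j + ennreal (q j / 2))))"
  proof (rule sum_prefix_mono_ennreal)
    fix i assume "i \<in> {1..n}"
    then show "(\<Sum>j=1..i. ennreal (q j * sp_mean_busy_time r q j))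
        \<le> (\<Sum>j=1..i. ennreal (q j) * (mean_start j + ennreal (q j / 2)))"
      by (intro busy_time_prefix_le mean_start_set_bound) auto
  qed (use w w_mono q_pos[THEN less_imp_le] in auto)
  also have "(\<Sum>j\<in>{1..n}. ennreal (w j / q j) * (ennreal (q j) * (mean_start j + ennreal (q j / 2))))
      = (\<Sum>j\<in>{1..n}. ennreal (w j) * (mean_start j + ennreal (q j / 2)))"
  proof (intro sum.cong refl)
    fix j assume j: "j \<in> {1..n}"
    have "ennreal (w j / q j) * ennreal (q j) = ennreal (w j)"
      using w[OF j] q_pos[OF j] by (subst ennreal_mult[symmetric]) auto
    then show "ennreal (w j / q j) * (ennreal (q j) * (mean_start j + ennreal (q j / 2)))
        = ennreal (w j) * (mean_start j + ennreal (q j / 2))"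
      by (simp add: mult.assoc[symmetric])
  qed
  also have "(\<Sum>j\<in>{1..n}. ennreal (w j / q j) * ennreal (q j * sp_mean_busy_time r q j))
      = (\<Sum>j\<in>{1..n}. ennreal (w j * sp_mean_busy_time r q j))"
    using w q_pos M0 by (intro sum.cong refl) (force simp: ennreal_mult'[symmetric])
  finally have main: "(\<Sum>j\<in>{1..n}. ennreal (w j * sp_mean_busy_time r q j))
      \<le> (\<Sum>j\<in>{1..n}. ennreal (w j) * (mean_start j + ennreal (q j / 2)))" .
  have "ennreal (\<Sum>j=1..n. w j * (sp_mean_busy_time r q j + q j / 2))
      = (\<Sum>j\<in>{1..n}. ennreal (w j * sp_mean_busy_time r q j)) + (\<Sum>j\<in>{1..n}. ennreal (w j) * ennreal (q j / 2))"
  proof -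
    have "ennreal (w j * (sp_mean_busy_time r q j + q j / 2))
        = ennreal (w j * sp_mean_busy_time r q j) + ennreal (w j) * ennreal (q j / 2)" if "j \<in> {1..n}" for j
      using w[OF that] M0[OF that] q_pos[OF that]
      by (subst ennreal_mult[symmetric], simp, simp, subst ennreal_plus[symmetric]) (auto simp: distrib_left)
    moreover have "ennreal (\<Sum>j=1..n. w j * (sp_mean_busy_time r q j + q j / 2))
        = (\<Sum>j=1..n. ennreal (w j * (sp_mean_busy_time r q j + q j / 2)))"
      using w M0 q_pos[THEN less_imp_le] by (intro sum_ennreal[symmetric]) auto
    ultimately show ?thesis by (simp only: sum.distrib[symmetric] cong: sum.cong)
  qed
  also have "\<dots> \<le> (\<Sum>j\<in>{1..n}. ennreal (w j) * (mean_start j + ennreal (q j / 2))) + (\<Sum>j\<in>{1..n}. ennreal (w j) * ennreal (q j / 2))"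
    by (intro add_right_mono main)
  also have "\<dots> = (\<Sum>j\<in>{1..n}. ennreal (w j) * (mean_start j + ennreal (q j)))"
    unfolding sum.distrib[symmetric]
  proof (intro sum.cong refl)
    fix j assume j: "j \<in> {1..n}"
    have "ennreal (q j) = ennreal (q j / 2) + ennreal (q j / 2)"
      using q_pos[OF j] by (subst ennreal_plus[symmetric]) auto
    then show "ennreal (w j) * (mean_start j + ennreal (q j / 2)) + ennreal (w j) * ennreal (q j / 2)
        = ennreal (w j) * (mean_start j + ennreal (q j))"
      by (simp add: distrib_left add.assoc)
  qed
  also have "\<dots> = (\<integral>\<^sup>+x. (\<Sum>j\<in>{1..n}. ennreal (w j) * (ennreal (policy_start j x) + ennreal (x j))) \<partial>?N)"
  proof -
    have "(\<integral>\<^sup>+x. (\<Sum>j\<in>{1..n}. ennreal (w j) * (ennreal (policy_start j x) + ennreal (x j))) \<partial>?N)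
        = (\<Sum>j\<in>{1..n}. \<integral>\<^sup>+x. ennreal (w j) * (ennreal (policy_start j x) + ennreal (x j)) \<partial>?N)"
      using policy_start_measurable component_measurable
      by (intro nn_integral_sum borel_measurable_times_ennreal borel_measurable_add
          measurable_compose[OF _ measurable_ennreal]) auto
    also have "\<dots> = (\<Sum>j\<in>{1..n}. ennreal (w j) * (mean_start j + ennreal (q j)))"
    proof (intro sum.cong refl)
      fix j assume j: "j \<in> {1..n}"
      note [measurable] = policy_start_measurable[OF j] component_measurable[OF j]
      show "(\<integral>\<^sup>+x. ennreal (w j) * (ennreal (policy_start j x) + ennreal (x j)) \<partial>?N)
          = ennreal (w j) * (mean_start j + ennreal (q j))"
        unfolding mean_start_def nn_integral_component[OF j, symmetric]
        by (subst nn_integral_cmult, measurable, subst nn_integral_add) measurable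
    qed
    finally show ?thesis ..
  qed
  also have "\<dots> = (\<integral>\<^sup>+x. ennreal (\<Sum>j=1..n. w j * completion \<pi> u x n j) \<partial>?N)"
  proof (rule nn_integral_cong_AE)
    have "AE x in ?N. \<forall>k\<in>{1..n}. 0 \<le> x k"
      using \<mu> \<mu>_nonneg by (intro AE_finite_allI AE_PiM_component) auto
    then show "AE x in ?N. (\<Sum>j\<in>{1..n}. ennreal (w j) * (ennreal (policy_start j x) + ennreal (x j)))
        = ennreal (\<Sum>j=1..n. w j * completion \<pi> u x n j)"
      using AE_space
    proof eventually_elim
      case (elim x)
      \<comment> \<open>Points of the product space are extensional, just as
        \<open>nonneg_part\<close> makes them, so the truncation changes nothing almost
        everywhere.\<close>
      then have x: "nonneg_part x = x"
        by (auto simp: nonneg_part_def space_PiM PiE_def extensional_def fun_eq_iff)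
      have C: "completion \<pi> u x n j = policy_start j x + x j" "0 \<le> policy_start j x" "0 \<le> x j" if "j \<in> {1..n}" for j
        using policy_start_completion[OF that, of x] policy_start_ge[OF that, of x] r_nonneg[OF that] elim that unfolding x by auto
      have "ennreal (\<Sum>j=1..n. w j * completion \<pi> u x n j) = (\<Sum>j=1..n. ennreal (w j * completion \<pi> u x n j))"
        using w C by (intro sum_ennreal[symmetric]) auto
      also have "\<dots> = (\<Sum>j\<in>{1..n}. ennreal (w j) * (ennreal (policy_start j x) + ennreal (x j)))"
        using w C by (intro sum.cong refl) (simp add: ennreal_mult)
      finally show ?case by simp
    qed
  qed
  finally show ?thesis .
qed

end

text \<open>Fubini over the seed reduces to a fixed \<open>u\<close>; by independence the joint law
  of the processing times is the product measure of the fixed-seed bound.\<close>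

lemma mean_busy_time_le_policy_cost:
  fixes M :: "'a measure" and p :: "nat \<Rightarrow> 'a \<Rightarrow> real"
  assumes "prob_space M" and \<pi>: "scheduling_policy n r \<pi>"
    and w: "\<And>j. j \<in> {1..n} \<Longrightarrow> 0 \<le> w j"
    and w_mono: "\<And>i j. 1 \<le> i \<Longrightarrow> i \<le> j \<Longrightarrow> j \<le> n \<Longrightarrow> w j / q j \<le> w i / q i"
    and indep: "prob_space.indep_vars M (\<lambda>_. borel) p {1..n}"
    and p_nonneg: "\<And>j. j \<in> {1..n} \<Longrightarrow> AE \<omega> in M. 0 \<le> p j \<omega>"
    and p_int: "\<And>j. j \<in> {1..n} \<Longrightarrow> integrable M (p j)"
    and q: "\<And>j. q j = (LINT \<omega>|M. p j \<omega>)"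
  shows "ennreal (\<Sum>j=1..n. w j * (sp_mean_busy_time r q j + q j / 2)) \<le> policy_cost n w M p \<pi>"
proof (cases "n = 0")
  case False
  then have ne: "{1..n} \<noteq> {}" by simp
  interpret M: prob_space M by fact
  have p_meas: "p k \<in> borel_measurable M" if "k \<in> {1..n}" for k using p_int[OF that] by auto
  \<comment> \<open>The point mass outside \<open>{1..n}\<close> is a default that makes every
    \<open>\<mu> k\<close> a probability space.\<close>
  define \<mu> where "\<mu> = (\<lambda>k. if k \<in> {1..n} then distr M borel (p k) else return borel 0)"
  have \<mu>: "prob_space (\<mu> k)" "sets (\<mu> k) = sets borel" for k
    using p_meas[of k] by (auto simp: \<mu>_def M.prob_space_distr prob_space_return)
  have \<mu>_mean: "(\<integral>\<^sup>+y. ennreal y \<partial>\<mu> k) = ennreal (q k)" if "k \<in> {1..n}" for k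
    using that p_meas[OF that] p_int[OF that] p_nonneg[OF that]
    by (simp add: \<mu>_def nn_integral_distr nn_integral_eq_integral q)
  have \<mu>_nonneg: "AE y in \<mu> k. 0 \<le> y" if "k \<in> {1..n}" for k
  proof -
    have "(AE y in distr M borel (p k). 0 \<le> y) \<longleftrightarrow> (AE \<omega> in M. 0 \<le> p k \<omega>)"
      using p_meas[OF that] by (intro AE_distr_iff) auto
    moreover have "\<mu> k = distr M borel (p k)" using that by (simp add: \<mu>_def)
    ultimately show ?thesis using p_nonneg[OF that] by (simp only:)
  qed
  define X where "X = (\<lambda>\<omega>. \<lambda>k\<in>{1..n}. p k \<omega>)"
  have X [measurable]: "X \<in> M \<rightarrow>\<^sub>M PiM {1..n} (\<lambda>_. borel)"
    unfolding X_def using p_meas by (intro measurable_restrict) auto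
  have distr: "distr M (PiM {1..n} (\<lambda>_. borel)) X = PiM {1..n} \<mu>"
  proof -
    have "distr M (PiM {1..n} (\<lambda>_. borel)) X = PiM {1..n} (\<lambda>k. distr M borel (p k))"
      using M.indep_vars_iff_distr_eq_PiM'[OF ne, where M'="\<lambda>_. borel" and X=p] p_meas indep by (simp add: X_def)
    also have "\<dots> = PiM {1..n} \<mu>" by (intro PiM_cong) (auto simp: \<mu>_def)
    finally show ?thesis .
  qed
  define V where "V = uniform_measure lborel {0..1::real}"
  interpret V: prob_space V unfolding V_def by (intro prob_space_uniform_measure) auto
  have sV [measurable_cong]: "sets V = sets borel" by (simp add: V_def)
  define g where "g = (\<lambda>u x. \<Sum>j=1..n. w j * completion \<pi> u x n j)"
  have g: "(\<lambda>z. g (fst z) (snd z)) \<in> borel_measurable (borel \<Otimes>\<^sub>M PiM {1..n} (\<lambda>_. borel))"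
    unfolding g_def using \<pi>
    by (intro borel_measurable_sum borel_measurable_times borel_measurable_const)
       (auto simp: scheduling_policy_def case_prod_beta')
  have gX: "(\<lambda>z. g (fst z) (X (snd z))) \<in> borel_measurable (V \<Otimes>\<^sub>M M)"
  proof -
    have "(\<lambda>z. (fst z, X (snd z))) \<in> V \<Otimes>\<^sub>M M \<rightarrow>\<^sub>M borel \<Otimes>\<^sub>M PiM {1..n} (\<lambda>_. borel)" by measurable
    from measurable_compose[OF this g] show ?thesis by simp
  qed
  have gu: "g u \<in> borel_measurable (PiM {1..n} (\<lambda>_. borel))" for u
    using measurable_compose[OF measurable_Pair1'[of u borel] g] by simp
  define LB where "LB = ennreal (\<Sum>j=1..n. w j * (sp_mean_busy_time r q j + q j / 2))"
  have "LB = (\<integral>\<^sup>+u. LB \<partial>V)" by (simp add: V.emeasure_space_1)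
  also have "\<dots> \<le> (\<integral>\<^sup>+u. \<integral>\<^sup>+\<omega>. ennreal (g u (X \<omega>)) \<partial>M \<partial>V)"
  proof (intro nn_integral_mono_AE)
    have "AE u in V. u \<in> {0..1}" unfolding V_def by (intro AE_uniform_measureI) auto
    then show "AE u in V. LB \<le> (\<integral>\<^sup>+\<omega>. ennreal (g u (X \<omega>)) \<partial>M)"
    proof eventually_elim
      case (elim u)
      have "LB \<le> (\<integral>\<^sup>+x. ennreal (g u x) \<partial>PiM {1..n} \<mu>)"
        unfolding LB_def g_def
        by (rule mean_busy_time_le_policy[OF \<pi> elim \<mu> \<mu>_mean w w_mono \<mu>_nonneg])
      also have "\<dots> = (\<integral>\<^sup>+\<omega>. ennreal (g u (X \<omega>)) \<partial>M)"
        unfolding distr[symmetric] using gu[of u] X by (intro nn_integral_distr) measurable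
      finally show ?case .
    qed
  qed
  also have "\<dots> = (\<integral>\<^sup>+z. ennreal (g (fst z) (X (snd z))) \<partial>(V \<Otimes>\<^sub>M M))"
    using gX by (subst M.nn_integral_fst[symmetric]) auto
  also have "\<dots> = policy_cost n w M p \<pi>"
    unfolding policy_cost_def V_def g_def X_def case_prod_beta' ..
  finally show ?thesis by (simp add: LB_def)
qed simp

end

section \<open>Comparison of RSOS with arbitrary and optimal policies\<close>

theorem theorem4:
  fixes M :: "'a measure" and n :: nat and w r :: "nat \<Rightarrow> real"
    and p :: "nat \<Rightarrow> 'a \<Rightarrow> real" and pbar :: "nat \<Rightarrow> real"
    and \<delta> c :: real and f :: "real \<Rightarrow> real"
  assumes "prob_space M"
    and "\<And>j. j \<in> {1..n} \<Longrightarrow> 0 \<le> w j"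
    and "\<And>j. j \<in> {1..n} \<Longrightarrow> 0 \<le> r j"
    and "prob_space.indep_vars M (\<lambda>_. borel) p {1..n}"
    and "\<And>j. j \<in> {1..n} \<Longrightarrow> AE \<omega> in M. 0 \<le> p j \<omega>"
    and "\<And>j. j \<in> {1..n} \<Longrightarrow> integrable M (p j)"
    and "\<And>j. pbar j = (LINT \<omega>|M. p j \<omega>)"
    and "\<And>j. j \<in> {1..n} \<Longrightarrow> 0 < pbar j"
    and "\<And>i j. 1 \<le> i \<Longrightarrow> i \<le> j \<Longrightarrow> j \<le> n \<Longrightarrow> w j / pbar j \<le> w i / pbar i"
    and "1 \<le> \<delta>"
    and "\<And>j. j \<in> {1..n} \<Longrightarrow> delta_NBUE M \<delta> (p j)"
    and "pdf_on_unit f"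
    and "\<And>x. x \<in> {0<..1} \<Longrightarrow> (LBINT \<alpha>:{0<..x}. \<delta> / (\<delta> + x - \<alpha>) * f \<alpha>) \<le> (c - 1) * x"
    and "\<And>x. x \<in> {0<..1} \<Longrightarrow>
           (1 + (LBINT \<alpha>:{0<..1}. \<delta> / (\<delta> + 1 - \<alpha>) * f \<alpha>)) * (LBINT \<alpha>:{1-x<..1}. f \<alpha>) \<le> c * x"
  shows "rsos_cost n w r M p f
           \<le> ennreal (c * (\<Sum>j=1..n. w j * (sp_mean_busy_time r pbar j + pbar j / 2)))
       \<and> (\<forall>OPT. optimal_policy n w r M p OPT \<longrightarrow>
            ennreal (c * (\<Sum>j=1..n. w j * (sp_mean_busy_time r pbar j + pbar j / 2)))
              \<le> ennreal c * policy_cost n w M p OPT)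
       \<and> ennreal (c * (\<Sum>j=1..n. w j * (sp_mean_busy_time r pbar j + pbar j / 2)))
            \<le> ennreal c * (INF \<pi>\<in>{\<pi>. scheduling_policy n r \<pi>}. policy_cost n w M p \<pi>)"
proof -
  interpret rsos_analysis n r pbar \<delta> c f
    using assms by unfold_locales auto
  define LB where "LB = (\<Sum>j=1..n. w j * (sp_mean_busy_time r pbar j + pbar j / 2))"
  have "rsos_cost n w r M p f \<le> ennreal (c * LB)"
    unfolding LB_def using assms(1,2,5,6,7,11) by (rule rsos_cost_le)
  moreover have lower: "ennreal (c * LB) \<le> ennreal c * policy_cost n w M p \<pi>"
    if "scheduling_policy n r \<pi>" for \<pi>
  proof -
    have "ennreal LB \<le> policy_cost n w M p \<pi>"
      unfolding LB_def using assms(1) that assms(2,9,4,5,6,7) by (rule mean_busy_time_le_policy_cost)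
    then show ?thesis using c_ge_1 by (simp add: ennreal_mult' mult_left_mono)
  qed
  \<comment> \<open>The bound holds for every policy and so passes to the infimum, whether or not
    that is attained.\<close>
  moreover have "ennreal (c * LB)
      \<le> ennreal c * (INF \<pi>\<in>{\<pi>. scheduling_policy n r \<pi>}. policy_cost n w M p \<pi>)"
  proof -
    have "ennreal LB \<le> (INF \<pi>\<in>{\<pi>. scheduling_policy n r \<pi>}. policy_cost n w M p \<pi>)"
      unfolding LB_def
      using mean_busy_time_le_policy_cost[OF assms(1) _ assms(2,9,4,5,6,7)] by (intro INF_greatest) auto
    then show ?thesis using c_ge_1 by (simp add: ennreal_mult' mult_left_mono)
  qed
  ultimately show ?thesis by (auto simp: LB_def optimal_policy_def)
qed

end
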